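(* Let $p$ and $q$ be primes with $p = 2q+1$. Let $K = \langle k_1\rangle \times \langle k_2 \rangle \times \cdots \times \langle k_p\rangle$ be the direct product of $p$ cyclic groups of order $p$, let $N = \langle k_1 k_2 \cdots k_p\rangle$, and let $H = K/N$. In the symmetric group $\mathrm{Sym}_p$, let $\alpha = (1\,2\,\ldots\,p)$, $A = \langle \alpha \rangle$, and let $\beta = (m_1 \ldots m_q)(n_1 \ldots n_q)$ where $\{m_1,\ldots,m_q,n_1,\ldots,n_q\} = \{2,3,\ldots,p\}$, and $B = \langle \beta\rangle$; assume moreover that $\alpha^{\beta} = \alpha^{r}$ for some integer $r$ with $1 < r < q$ and $r^q \equiv 1 \pmod p$, so that $A \rtimes B$ is a subgroup of $\mathrm{Sym}_p$. Let $A \rtimes B$ act on $H$ by permuting indices: for $\gamma \in A\rtimes B$ and integers $x_1,\ldots,x_p$, $$(k_1^{x_1}k_2^{x_2}\cdots k_p^{x_p}N)^{\gamma} = k_{1^{\gamma}}^{x_1}k_{2^{\gamma}}^{x_2}\cdots k_{p^{\gamma}}^{x_p}N,$$ and let $G = H \rtimes (A \rtimes B)$ be the corresponding semidirect product. Then $$\mathrm{N}(G) = \{1, p, p^{p-2}\} \times \{1, q\}$$ and $Z(G) = 1$.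
   Context: For a finite group $G$, $\mathrm{N}(G)$ denotes the set of conjugacy class sizes of $G$, i.e. $\{|G : C_G(x)| : x \in G\}$. For sets of positive integers $\Omega,\Delta$, $\Omega \times \Delta$ denotes the set of products $\{\omega\delta : \omega \in \Omega, \delta \in \Delta\}$. $Z(G)$ is the center of $G$. $i^{\gamma}$ denotes the image of $i \in \{1,\ldots,p\}$ under the permutation $\gamma$ (permutations act on the right), and $\alpha^\beta = \beta^{-1}\alpha\beta$. *)

theory Defs
  imports "HOL-Algebra.Algebra" "HOL-Combinatorics.Cycles" "HOL-Number_Theory.Cong"
begin

definition centralizer :: "('a, 'b) monoid_scheme \<Rightarrow> 'a \<Rightarrow> 'a set" where
  "centralizer G x = {g \<in> carrier G. g \<otimes>\<^bsub>G\<^esub> x = x \<otimes>\<^bsub>G\<^esub> g}"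

definition center :: "('a, 'b) monoid_scheme \<Rightarrow> 'a set" where
  "center G = {z \<in> carrier G. \<forall>g \<in> carrier G. z \<otimes>\<^bsub>G\<^esub> g = g \<otimes>\<^bsub>G\<^esub> z}"

definition class_sizes :: "('a, 'b) monoid_scheme \<Rightarrow> nat set" where
  "class_sizes G = {card (carrier G) div card (centralizer G x) | x. x \<in> carrier G}"

definition set_times :: "nat set \<Rightarrow> nat set \<Rightarrow> nat set" where
  "set_times \<Omega> \<Delta> = {w * d | w d. w \<in> \<Omega> \<and> d \<in> \<Delta>}"

text \<open>K = <k_1> x ... x <k_p>, cyclic groups of order p, indexed by {1..p};
  the element k_1^{x_1}...k_p^{x_p} is the function i |-> x_i mod p.\<close>
definition K_grp :: "nat \<Rightarrow> (nat \<Rightarrow> int) monoid" where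
  "K_grp p = product_group {1..p} (\<lambda>_. integer_mod_group p)"

definition N_grp :: "nat \<Rightarrow> (nat \<Rightarrow> int) set" where
  "N_grp p = generate (K_grp p) {(\<lambda>i\<in>{1..p}. 1)}"

definition H_grp :: "nat \<Rightarrow> (nat \<Rightarrow> int) set monoid" where
  "H_grp p = K_grp p Mod N_grp p"

definition alpha_perm :: "nat \<Rightarrow> nat \<Rightarrow> nat" where
  "alpha_perm p i = (if 1 \<le> i \<and> i < p then i + 1 else if i = p then 1 else i)"

definition AB_set :: "nat \<Rightarrow> (nat \<Rightarrow> nat) \<Rightarrow> (nat \<Rightarrow> nat) set" where
  "AB_set p \<beta> = generate (sym_group p) {alpha_perm p, \<beta>}"

text \<open>Right action of a permutation gamma on H by permuting indices:
  (k_1^{x_1}...k_p^{x_p}N)^gamma = k_{1^gamma}^{x_1}...k_{p^gamma}^{x_p}N,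
  i.e. the exponent vector x becomes y with y (gamma i) = x i, y = x o gamma^{-1}.\<close>
definition act :: "(nat \<Rightarrow> nat) \<Rightarrow> (nat \<Rightarrow> int) set \<Rightarrow> (nat \<Rightarrow> int) set" where
  "act \<gamma> C = (\<lambda>x. x \<circ> Hilbert_Choice.inv \<gamma>) ` C"

text \<open>Semidirect product G = H x| (A x| B).  Elements are pairs (h, gamma)
  standing for h gamma, with gamma^{-1} h gamma = h^gamma.  Permutations act on
  the right, so the product gamma_1 gamma_2 in Sym_p (first gamma_1, then gamma_2)
  is the function gamma_2 o gamma_1.  Hence
  (h1 gamma1)(h2 gamma2) = h1 h2^{gamma1^{-1}} gamma1 gamma2.\<close>
definition G_grp :: "nat \<Rightarrow> (nat \<Rightarrow> nat) \<Rightarrow> ((nat \<Rightarrow> int) set \<times> (nat \<Rightarrow> nat)) monoid" where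
  "G_grp p \<beta> = \<lparr> carrier = carrier (H_grp p) \<times> AB_set p \<beta>,
      monoid.mult = (\<lambda>(h1, \<gamma>1) (h2, \<gamma>2). (h1 \<otimes>\<^bsub>H_grp p\<^esub> act (Hilbert_Choice.inv \<gamma>1) h2, \<gamma>2 \<circ> \<gamma>1)),
      one = (\<one>\<^bsub>H_grp p\<^esub>, id) \<rparr>"

end

theory Submission
  imports Defs "HOL-Number_Theory.Pocklington"
begin

text \<open>
  Identify the index \<open>i\<close> with the residue \<open>i - 1\<close> modulo \<open>p\<close>. Then \<open>\<alpha>\<close> is \<open>t \<mapsto> t + 1\<close>, and since
  \<open>\<beta>\<close> fixes the index 1 and conjugates \<open>\<alpha>\<close> to \<open>\<alpha>\<^sup>r\<close>, it is \<open>t \<mapsto> r t\<close>; so \<open>A \<rtimes> B\<close> is the group of the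
  \<open>p q\<close> affine maps \<open>t \<mapsto> r\<^sup>k t + b\<close>, acting on functions \<open>u\<close> on the residues modulo constants.

  An element \<open>h\<close> of \<open>H\<close> has class size \<open>p q\<close> divided by the order of its stabiliser in \<open>A \<rtimes> B\<close>;
  the orders \<open>p q\<close>, \<open>p\<close>, \<open>q\<close>, \<open>1\<close> occur for \<open>u = 0\<close>, \<open>u t = t\<close>, and for \<open>u\<close> supported on \<open>{0}\<close>
  and on \<open>{0, 1}\<close> (with distinct values). If \<open>\<gamma> \<noteq> 1\<close>, the centraliser of \<open>\<gamma>\<close> in \<open>A \<rtimes> B\<close> is \<open>\<langle>\<gamma>\<rangle>\<close>, so the
  centraliser of \<open>h \<gamma>\<close> has order \<open>|\<gamma>|\<close> times the number of fixed points of \<open>\<gamma>\<close> in \<open>H\<close>. These are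
  the linear functions for a translation (\<open>p\<close> of them), and the functions constant on the three
  orbits for a map with \<open>r\<^sup>k \<noteq> 1\<close> (\<open>p\<^sup>2\<close> of them).
\<close>

section \<open>The affine group\<close>

locale affine_data =
  fixes p q r :: nat
  assumes p_prime: "Factorial_Ring.prime p" and q_prime: "Factorial_Ring.prime q"
    and p_eq: "p = 2 * q + 1"
    and r_gt: "1 < r" and r_less: "r < q" and r_pow: "[r ^ q = 1] (mod p)"
begin

declare One_nat_def [simp del]

abbreviation P :: int where "P \<equiv> int p"
abbreviation R :: int where "R \<equiv> int r"

lemma q_ge: "q \<ge> 3" using r_gt r_less by linarith
lemma p_ge: "p \<ge> 7" using q_ge p_eq by linarith
lemma P_pos [simp]: "P > 0" using p_ge by linarith
lemma p_pos [simp]: "p > 0" using p_ge by linarith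
lemma P_prime: "Factorial_Ring.prime P" using p_prime by simp

section \<open>Powers of \<open>r\<close> modulo \<open>p\<close>\<close>

lemma coprime_pr: "coprime p r"
  using p_prime r_gt r_less p_eq by (intro prime_imp_coprime) (auto dest: dvd_imp_le)

text \<open>The order divides the prime \<open>q\<close>, and it is not 1 because
  \<open>1 < r < p\<close>. So exponents of \<open>R\<close> count modulo \<open>q\<close>, and
  \<open>R\<close> generates the subgroup of index 2 in the units modulo \<open>p\<close>.\<close>

lemma ord_r: "ord p r = q"
proof -
  have "ord p r dvd q" using r_pow ord_divides by blast
  moreover have "ord p r \<noteq> 1"
  proof
    assume "ord p r = 1"
    then have "[r ^ 1 = 1] (mod p)" using ord_divides[of r 1 p] by simp
    then show False using r_gt r_less p_eq by (simp add: cong_def)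
  qed
  ultimately show ?thesis using q_prime by (auto simp: prime_nat_iff)
qed

lemma R_pow_cong_iff: "[R ^ k = R ^ l] (mod P) \<longleftrightarrow> [k = l] (mod q)"
  using order_divides_expdiff[OF coprime_pr, of k l] cong_int_iff[of "r ^ k" "r ^ l" p]
  by (simp add: ord_r)

lemma R_pow_one_iff: "[R ^ k = 1] (mod P) \<longleftrightarrow> [k = 0] (mod q)"
  using R_pow_cong_iff[of k 0] by simp

lemma R_pow_mult_q [simp]: "[R ^ (q * k) = 1] (mod P)" "[R ^ (k * q) = 1] (mod P)"
  by (subst R_pow_one_iff, simp add: cong_def)+

lemma coprime_R_pow: "coprime (R ^ k) P"
  using coprime_pr by (simp add: coprime_commute)

lemma R_pow_cancel: "[R ^ k * s = R ^ k * t] (mod P) \<longleftrightarrow> [s = t] (mod P)"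
  using coprime_R_pow by (rule cong_mult_lcancel)

lemma coprime_P_iff: "coprime s P \<longleftrightarrow> \<not> [s = 0] (mod P)"
  using P_prime by (metis cong_0_iff coprime_commute not_coprimeI prime_imp_coprime dvd_refl not_prime_unit)

section \<open>Indices as residues, permutations as affine maps\<close>

definition idx :: "int \<Rightarrow> nat" where "idx t = Suc (nat (t mod P))"

lemma idx_eq_iff: "idx s = idx t \<longleftrightarrow> [s = t] (mod P)"
  by (simp add: idx_def cong_def eq_nat_nat_iff)

lemma idx_in [simp]: "idx t \<in> {1..p}"
proof -
  have "t mod P < P" by simp
  then have "nat (t mod P) < p" using nat_less_iff[of "t mod P" p] by simp
  then show ?thesis by (simp add: idx_def)
qed

lemma idx_of_nat [simp]: "i \<in> {1..p} \<Longrightarrow> idx (int i - 1) = i"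
  by (auto simp: idx_def)

lemma int_idx: "int (idx t) - 1 = t mod P"
  by (simp add: idx_def)

lemma idx_cases:
  assumes "i \<in> {1..p}" obtains t where "i = idx t" "0 \<le> t" "t < P"
  using assms idx_of_nat[OF assms] that[of "int i - 1"] by auto

text \<open>The linear part is stored as an exponent of \<open>R\<close>, so composition adds
  exponents. Outside \<open>{1..p}\<close> the map is the identity, as membership in
  \<open>sym_group p\<close> demands.\<close>

definition aff :: "nat \<Rightarrow> int \<Rightarrow> nat \<Rightarrow> nat" where
  "aff k b i = (if i \<in> {1..p} then idx (R ^ k * (int i - 1) + b) else i)"

lemma aff_idx [simp]: "aff k b (idx t) = idx (R ^ k * t + b)"
proof -
  have "[R ^ k * (t mod P) + b = R ^ k * t + b] (mod P)"
    by (intro cong_add cong_mult cong_refl) simp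
  then show ?thesis using idx_in[of t] by (simp add: aff_def int_idx idx_eq_iff)
qed

lemma aff_outside: "i \<notin> {1..p} \<Longrightarrow> aff k b i = i"
  by (simp only: aff_def if_False)

lemma perm_eqI:
  assumes "\<And>i. i \<notin> {1..p} \<Longrightarrow> f i = g i" "\<And>t. f (idx t) = g (idx t)"
  shows "f = (g :: nat \<Rightarrow> nat)"
proof
  fix i show "f i = g i"
    using assms by (cases "i \<in> {1..p}") (auto elim: idx_cases simp del: atLeastAtMost_iff)
qed

lemma aff_comp: "aff k b \<circ> aff l c = aff (k + l) (R ^ k * c + b)"
  by (rule perm_eqI) (simp_all add: aff_outside algebra_simps power_add del: atLeastAtMost_iff)

text \<open>The values at the residues 0 and 1 recover \<open>b\<close> and \<open>R ^ k\<close>,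
  and \<open>R ^ k\<close> determines \<open>k\<close> modulo \<open>q\<close>.\<close>

lemma aff_eq_iff: "aff k b = aff l c \<longleftrightarrow> [k = l] (mod q) \<and> [b = c] (mod P)"
proof
  assume eq: "aff k b = aff l c"
  have *: "[R ^ k * t + b = R ^ l * t + c] (mod P)" for t
    using fun_cong[OF eq, of "idx t"] by (simp add: idx_eq_iff)
  have bc: "[b = c] (mod P)" using *[of 0] by simp
  have "[R ^ k + b = R ^ l + c] (mod P)" using *[of 1] by simp
  then have "[R ^ k = R ^ l] (mod P)" using bc
    by (metis add_diff_cancel_right' cong_diff)
  then show "[k = l] (mod q) \<and> [b = c] (mod P)" using bc R_pow_cong_iff by simp
next
  assume "[k = l] (mod q) \<and> [b = c] (mod P)"
  then have "[R ^ k * t + b = R ^ l * t + c] (mod P)" for t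
    by (intro cong_add cong_mult cong_refl) (auto simp: R_pow_cong_iff)
  then show "aff k b = aff l c"
    by (intro perm_eqI) (simp_all add: aff_outside idx_eq_iff del: atLeastAtMost_iff)
qed

lemma aff_0_0: "aff 0 0 = id"
  by (rule perm_eqI) (simp_all add: aff_outside del: atLeastAtMost_iff)

text \<open>Exponents are natural numbers, so \<open>(q - 1) * k\<close> stands in for
  \<open>-k\<close>: the two add up to \<open>q * k\<close>, and \<open>R ^ (q * k)\<close> is 1
  modulo \<open>p\<close>.\<close>

lemma aff_inverse_right:
  "aff k b \<circ> aff ((q - 1) * k) (- (R ^ ((q - 1) * k) * b)) = id"
proof -
  have e: "k + (q - 1) * k = q * k" using q_ge by (simp add: algebra_simps)
  have "[R ^ (q * k) * b = 1 * b] (mod P)" by (intro cong_mult cong_refl) simp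
  then have "[b - R ^ (q * k) * b = 0] (mod P)"
    by (simp add: cong_iff_dvd_diff dvd_diff_commute)
  then show ?thesis
    by (subst aff_0_0[symmetric], subst aff_comp, subst aff_eq_iff)
       (simp add: mult.assoc[symmetric] power_add[symmetric] e cong_def)
qed

lemma aff_inverse_left:
  "aff ((q - 1) * k) (- (R ^ ((q - 1) * k) * b)) \<circ> aff k b = id"
proof -
  have e: "(q - 1) * k + k = q * k" using q_ge by (simp add: algebra_simps)
  show ?thesis
    by (subst aff_0_0[symmetric], subst aff_comp, subst aff_eq_iff)
       (simp add: e cong_def)
qed

lemma inv_aff: "Hilbert_Choice.inv (aff k b) = aff ((q - 1) * k) (- (R ^ ((q - 1) * k) * b))"
  using aff_inverse_left aff_inverse_right by (metis inv_unique_comp)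

lemma aff_permutes: "aff k b permutes {1..p}"
proof -
  have "bij (aff k b)" using aff_inverse_left aff_inverse_right by (rule o_bij)
  then show ?thesis unfolding permutes_def bij_iff using aff_outside by blast
qed

lemma aff_funpow: "\<exists>b'. aff k b ^^ i = aff (i * k) b'"
proof (induction i)
  case 0 show ?case by (rule exI[of _ 0]) (simp add: aff_0_0 flip: id_def)
next
  case (Suc i)
  then obtain c where "aff k b ^^ i = aff (i * k) c" by blast
  then have "aff k b ^^ Suc i = aff k b \<circ> aff (i * k) c" by (simp only: funpow.simps)
  then show ?case by (auto simp: aff_comp)
qed

lemma aff_0_funpow: "aff 0 b ^^ i = aff 0 (int i * b)"
  by (induction i) (simp_all add: aff_0_0 aff_comp algebra_simps flip: id_def)

lemma aff_k0_funpow: "aff k 0 ^^ i = aff (i * k) 0"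
  by (induction i) (simp_all add: aff_0_0 aff_comp algebra_simps flip: id_def)

lemma alpha_perm_eq: "alpha_perm p = aff 0 1"
proof
  fix i
  consider "i \<in> {1..<p}" | "i = p" | "i \<notin> {1..p}" using p_ge by fastforce
  then show "alpha_perm p i = aff 0 1 i"
  proof cases
    case 1
    then have "int i mod P = int i" by simp
    with 1 show ?thesis by (auto simp: alpha_perm_def aff_def idx_def)
  next
    case 2 then show ?thesis using p_pos by (simp add: alpha_perm_def aff_def idx_def del: p_pos)
  qed (use p_ge in \<open>auto simp: alpha_perm_def aff_def\<close>)
qed

section \<open>The group of affine maps and its generators\<close>

definition affs :: "(nat \<Rightarrow> nat) set" where "affs = range (\<lambda>(k, b). aff k b)"

lemma aff_in_affs [simp]: "aff k b \<in> affs" by (auto simp: affs_def)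

lemma affs_cases: assumes "\<gamma> \<in> affs" obtains k b where "\<gamma> = aff k b"
  using assms by (auto simp: affs_def)

lemma affs_eq: "affs = (\<lambda>(k, b). aff k b) ` ({..<q} \<times> {0..<P})"
proof -
  have "aff k b = aff (k mod q) (b mod P)" for k b by (simp add: aff_eq_iff)
  moreover have "k mod q < q" for k using q_ge by simp
  ultimately show ?thesis unfolding affs_def by (force simp: image_iff)
qed

lemma card_affs: "card affs = p * q"
proof -
  have "inj_on (\<lambda>(k, b). aff k b) ({..<q} \<times> {0..<P})"
    by (auto simp: inj_on_def aff_eq_iff cong_def)
  then show ?thesis by (simp add: affs_eq card_image)
qed

lemma finite_affs: "finite affs" by (simp add: affs_eq)

lemma subgroup_affs: "subgroup affs (sym_group p)"
proof (rule group.subgroupI[OF sym_group_is_group])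
  show "affs \<subseteq> carrier (sym_group p)"
    by (auto simp: sym_group_carrier elim!: affs_cases intro: aff_permutes)
  show "affs \<noteq> {}" by (auto simp: affs_def)
  fix a assume a: "a \<in> affs"
  then show "inv\<^bsub>sym_group p\<^esub> a \<in> affs"
    by (auto simp: sym_group_inv_equality sym_group_carrier inv_aff aff_permutes elim!: affs_cases)
  fix b assume "b \<in> affs"
  with a show "a \<otimes>\<^bsub>sym_group p\<^esub> b \<in> affs"
    by (auto simp: sym_group_mult aff_comp elim!: affs_cases)
qed

lemma AB_set_eq: "AB_set p (aff 1 0) = affs"
proof
  show "AB_set p (aff 1 0) \<subseteq> affs" unfolding AB_set_def
    by (rule group.generate_subgroup_incl[OF sym_group_is_group _ subgroup_affs])
       (simp add: alpha_perm_eq)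
  have pow: "\<gamma> \<in> AB_set p (aff 1 0) \<Longrightarrow> \<gamma> ^^ i \<in> AB_set p (aff 1 0)" for \<gamma> i
  proof (induction i)
    case 0 show ?case
      using generate.one[of "sym_group p"] by (simp add: AB_set_def sym_group_one id_def)
  next
    case (Suc i) then show ?case
      using generate.eng[of \<gamma> "sym_group p" _ "\<gamma> ^^ i"]
      by (simp add: AB_set_def sym_group_mult comp_def)
  qed
  show "affs \<subseteq> AB_set p (aff 1 0)"
  proof
    fix \<gamma> assume "\<gamma> \<in> affs"
    \<comment> \<open>Choosing the representative \<open>b\<close> in \<open>{0..<P}\<close> makes
      it usable as the exponent \<open>nat b\<close> of the translation by 1.\<close>
    then obtain k b where g: "\<gamma> = aff k b" "0 \<le> b" by (auto simp: affs_eq)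
    then have "\<gamma> = aff 0 1 ^^ nat b \<circ> aff 1 0 ^^ k"
      by (simp add: aff_0_funpow aff_k0_funpow aff_comp)
    moreover have "aff 0 1 \<in> AB_set p (aff 1 0)" "aff 1 0 \<in> AB_set p (aff 1 0)"
      by (auto simp: AB_set_def alpha_perm_eq intro: generate.incl)
    ultimately show "\<gamma> \<in> AB_set p (aff 1 0)"
      using pow[of "aff 0 1" "nat b"] pow[of "aff 1 0" k] generate.eng[of _ "sym_group p"]
      by (simp add: AB_set_def sym_group_mult comp_def)
  qed
qed

section \<open>Functions on residues modulo constants\<close>

text \<open>Such a \<open>u\<close> stands for a map from residues to residues modulo
  \<open>p\<close>. Values need only be congruent, so linear functions qualify without being
  reduced.\<close>

definition periodic :: "(int \<Rightarrow> int) \<Rightarrow> bool" where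
  "periodic u \<longleftrightarrow> (\<forall>s t. [s = t] (mod P) \<longrightarrow> [u s = u t] (mod P))"

lemma periodicD: "periodic u \<Longrightarrow> [s = t] (mod P) \<Longrightarrow> [u s = u t] (mod P)"
  by (simp add: periodic_def)

lemma periodic_intros [intro, simp]:
  "periodic (\<lambda>_. c)"
  "periodic (\<lambda>t. a * t)"
  "periodic u \<Longrightarrow> periodic v \<Longrightarrow> periodic (\<lambda>t. u t + v t)"
  "periodic u \<Longrightarrow> periodic (\<lambda>t. - u t)"
  "periodic u \<Longrightarrow> periodic (\<lambda>t. u (a * t + b))"
  "periodic u \<Longrightarrow> periodic (\<lambda>t. u (t + b))"
proof -
  show "periodic (\<lambda>t. u (a * t + b))" if "periodic u"
    unfolding periodic_def
    by (intro allI impI periodicD[OF that] cong_add cong_mult cong_refl)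
  show "periodic (\<lambda>t. u (t + b))" if "periodic u"
    unfolding periodic_def
    by (intro allI impI periodicD[OF that] cong_add cong_refl)
qed (auto simp: periodic_def cong_minus_minus_iff intro!: cong_add cong_mult)

text \<open>The exponent vector of \<open>u\<close>: the exponent of \<open>k_i\<close> is the value
  at the residue \<open>i - 1\<close>, reduced to the representative that the cyclic factor
  uses.\<close>

definition vec :: "(int \<Rightarrow> int) \<Rightarrow> nat \<Rightarrow> int" where
  "vec u = (\<lambda>i\<in>{1..p}. u (int i - 1) mod P)"

lemma vec_idx: "periodic u \<Longrightarrow> vec u (idx t) = u t mod P"
  using periodicD[of u "t mod P" t] idx_in[of t] by (simp add: vec_def int_idx cong_def)

lemma vec_outside: "i \<notin> {1..p} \<Longrightarrow> vec u i = undefined"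
  unfolding vec_def by (simp only: restrict_def if_False)

lemma vec_eq_iff:
  assumes "periodic u" "periodic v"
  shows "vec u = vec v \<longleftrightarrow> (\<forall>t. [u t = v t] (mod P))"
proof
  assume "vec u = vec v"
  then show "\<forall>t. [u t = v t] (mod P)" using vec_idx assms unfolding cong_def by metis
next
  assume *: "\<forall>t. [u t = v t] (mod P)"
  show "vec u = vec v"
    by (rule ext, use * in \<open>auto simp: vec_def cong_def restrict_def\<close>)
qed

section \<open>The groups \<open>K\<close>, \<open>N\<close> and \<open>H\<close> in terms of
  functions\<close>

lemma carrier_K: "carrier (K_grp p) = {1..p} \<rightarrow>\<^sub>E {0..<P}"
  by (simp add: K_grp_def carrier_integer_mod_group)

lemma comm_group_K: "comm_group (K_grp p)"
proof (rule group.group_comm_groupI)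
  show "group (K_grp p)" by (simp add: K_grp_def)
qed (simp add: K_grp_def add.commute)

lemma vec_in: "vec u \<in> carrier (K_grp p)"
  by (auto simp: vec_def carrier_K)

lemma vec_mult: "vec u \<otimes>\<^bsub>K_grp p\<^esub> vec v = vec (\<lambda>t. u t + v t)"
  by (auto simp: vec_def K_grp_def mod_add_eq)

lemma vec_one: "\<one>\<^bsub>K_grp p\<^esub> = vec (\<lambda>_. 0)"
  by (auto simp: vec_def K_grp_def)

lemma vec_inv: "inv\<^bsub>K_grp p\<^esub> (vec u) = vec (\<lambda>t. - u t)"
  by (rule group.inv_equality)
     (simp_all add: vec_mult vec_one vec_in comm_group.axioms(2) comm_group_K)

lemma K_cases:
  assumes "x \<in> carrier (K_grp p)" obtains u where "periodic u" "x = vec u"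
proof
  show "periodic (\<lambda>t. x (idx t))" by (simp add: periodic_def idx_eq_iff[symmetric])
  show "x = vec (\<lambda>t. x (idx t))"
  proof
    fix i show "x i = vec (\<lambda>t. x (idx t)) i"
      using assms unfolding carrier_K
      by (cases "i \<in> {1..p}") (auto simp: vec_def PiE_def extensional_def Pi_def simp del: atLeastAtMost_iff)
  qed
qed

lemma N_eq: "N_grp p = range (\<lambda>c. vec (\<lambda>_. c))"
proof
  have ones: "(\<lambda>i\<in>{1..p}. 1) = vec (\<lambda>_. 1)" using p_ge by (auto simp: vec_def)
  interpret comm_group "K_grp p" by (rule comm_group_K)
  have sub: "subgroup (range (\<lambda>c. vec (\<lambda>_. c))) (K_grp p)"
    by (rule subgroupI) (auto simp: vec_in vec_inv vec_mult)
  show "N_grp p \<subseteq> range (\<lambda>c. vec (\<lambda>_. c))" unfolding N_grp_def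
    by (rule generate_subgroup_incl[OF _ sub]) (simp add: ones)
  \<comment> \<open>Powers of the generator reach the natural constants by induction; any integer
    constant gives the same vector as its remainder modulo \<open>P\<close>, which is one of
    them.\<close>
  have nat: "vec (\<lambda>_. int n) \<in> N_grp p" for n
  proof (induction n)
    case 0 show ?case using generate.one by (simp add: N_grp_def vec_one[symmetric])
  next
    case (Suc n)
    have "vec (\<lambda>_. int n) \<otimes>\<^bsub>K_grp p\<^esub> vec (\<lambda>_. 1) \<in> N_grp p"
      using Suc unfolding N_grp_def by (rule generate.eng) (auto simp: ones intro: generate.incl)
    then show ?case by (simp add: vec_mult add.commute)
  qed
  have "vec (\<lambda>_. c) = vec (\<lambda>_. int (nat (c mod P)))" for c
    by (subst vec_eq_iff) simp_all
  then have "vec (\<lambda>_. c) \<in> N_grp p" for c using nat[of "nat (c mod P)"] by metis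
  then show "range (\<lambda>c. vec (\<lambda>_. c)) \<subseteq> N_grp p" by auto
qed

lemma card_N: "card (N_grp p) = p"
proof -
  have "vec (\<lambda>_. c) = vec (\<lambda>_. c mod P)" for c by (subst vec_eq_iff) simp_all
  moreover have "c mod P \<in> {0..<P}" for c by simp
  ultimately have "N_grp p = (\<lambda>c. vec (\<lambda>_. c)) ` {0..<P}" unfolding N_eq by blast
  moreover have "inj_on (\<lambda>c. vec (\<lambda>_. c)) {0..<P}"
    by (rule inj_onI) (simp add: vec_eq_iff cong_def)
  ultimately show ?thesis by (simp add: card_image)
qed

lemma subgroup_N: "subgroup (N_grp p) (K_grp p)"
  unfolding N_eq
  by (rule group.subgroupI[OF comm_group.axioms(2)[OF comm_group_K]])
     (auto simp: vec_in vec_inv vec_mult)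

lemma normal_N: "N_grp p \<lhd> K_grp p"
  using comm_group.subgroup_imp_normal[OF comm_group_K subgroup_N] .

lemma comm_group_H: "comm_group (H_grp p)"
  unfolding H_grp_def using comm_group.abelian_FactGroup[OF comm_group_K subgroup_N] .

lemma card_H: "card (carrier (H_grp p)) = p ^ (p - 1)"
proof -
  have "card (carrier (H_grp p)) * p = p ^ p"
    using group.lagrange[OF comm_group.axioms(2)[OF comm_group_K] subgroup_N]
    by (simp add: H_grp_def FactGroup_def card_N order_def carrier_K card_PiE)
  also have "\<dots> = p ^ (p - 1) * p" using p_pos by (metis power_minus_mult)
  finally show ?thesis using p_ge by simp
qed

lemma finite_H: "finite (carrier (H_grp p))"
  using card_H p_pos by (metis card.infinite power_not_zero less_numeral_extra(3))

definition hcls :: "(int \<Rightarrow> int) \<Rightarrow> (nat \<Rightarrow> int) set" where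
  "hcls u = N_grp p #>\<^bsub>K_grp p\<^esub> vec u"

lemma hcls_eq: "hcls u = range (\<lambda>c. vec (\<lambda>t. c + u t))"
  by (auto simp: hcls_def r_coset_def N_eq vec_mult)

lemma hcls_in [simp]: "hcls u \<in> carrier (H_grp p)"
  by (auto simp: hcls_def H_grp_def FactGroup_def RCOSETS_def vec_in)

lemma H_cases:
  assumes "h \<in> carrier (H_grp p)" obtains u where "periodic u" "h = hcls u"
  using assms by (auto simp: hcls_def H_grp_def FactGroup_def RCOSETS_def elim!: K_cases)

lemma hcls_mult: "hcls u \<otimes>\<^bsub>H_grp p\<^esub> hcls v = hcls (\<lambda>t. u t + v t)"
  by (simp add: H_grp_def hcls_def normal.rcos_sum[OF normal_N] vec_in vec_mult)

lemma hcls_one: "\<one>\<^bsub>H_grp p\<^esub> = hcls (\<lambda>_. 0)"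
  by (simp add: H_grp_def hcls_eq N_eq)

text \<open>Representatives of one coset differ by an element of \<open>N\<close>, that is, by a
  constant. Equations in \<open>H\<close> thereby become congruences up to an additive constant
  \<open>c\<close>, the form in which all fixed points and stabilisers are computed.\<close>

lemma hcls_eq_iff:
  assumes "periodic u" "periodic v"
  shows "hcls u = hcls v \<longleftrightarrow> (\<exists>c. \<forall>t. [u t = v t + c] (mod P))"
proof
  assume "hcls u = hcls v"
  moreover have "vec u \<in> hcls u" unfolding hcls_eq by (rule image_eqI[of _ _ 0]) simp_all
  ultimately obtain c where "vec u = vec (\<lambda>t. c + v t)" unfolding hcls_eq by auto
  then show "\<exists>c. \<forall>t. [u t = v t + c] (mod P)"
    using assms by (subst (asm) vec_eq_iff) (auto simp: add.commute)
next
  assume "\<exists>c. \<forall>t. [u t = v t + c] (mod P)"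
  then obtain c where c: "\<And>t. [u t = v t + c] (mod P)" by auto
  have "vec (\<lambda>t. d + u t) = vec (\<lambda>t. (d + c) + v t)" for d
  proof (subst vec_eq_iff)
    show "\<forall>t. [d + u t = d + c + v t] (mod P)"
      using cong_add[OF cong_refl c, of d] by (simp add: algebra_simps)
  qed (use assms in auto)
  moreover have "\<exists>e. d = e + c" for d by (metis diff_add_cancel)
  ultimately show "hcls u = hcls v"
    unfolding hcls_eq by (auto simp: image_iff) metis
qed

text \<open>The product in \<open>G_grp\<close> twists by the inverse permutation, and
  \<open>act\<close> composes with an inverse once more. The two cancel, so for an affine \<gamma>
  this is plain precomposition with \<gamma>.\<close>

abbreviation shift :: "(nat \<Rightarrow> nat) \<Rightarrow> (nat \<Rightarrow> int) set \<Rightarrow> (nat \<Rightarrow> int) set" where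
  "shift \<gamma> \<equiv> act (Hilbert_Choice.inv \<gamma>)"

lemma vec_aff:
  assumes "periodic u" shows "vec u \<circ> aff k b = vec (\<lambda>t. u (R ^ k * t + b))"
proof
  fix i show "(vec u \<circ> aff k b) i = vec (\<lambda>t. u (R ^ k * t + b)) i"
  proof (cases "i \<in> {1..p}")
    case True
    then obtain t where "i = idx t" by (rule idx_cases)
    then show ?thesis using assms by (simp add: vec_idx)
  qed (simp add: vec_outside aff_outside del: atLeastAtMost_iff)
qed

lemma shift_hcls:
  assumes "periodic u" shows "shift (aff k b) (hcls u) = hcls (\<lambda>t. u (R ^ k * t + b))"
proof -
  have "bij (aff k b)" using aff_permutes by (rule permutes_bij)
  then have "Hilbert_Choice.inv (Hilbert_Choice.inv (aff k b)) = aff k b" by (rule inv_inv_eq)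
  then show ?thesis using assms
    by (simp add: act_def hcls_eq image_image vec_aff)
qed

lemma shift_in: "\<gamma> \<in> affs \<Longrightarrow> h \<in> carrier (H_grp p) \<Longrightarrow> shift \<gamma> h \<in> carrier (H_grp p)"
  by (auto elim!: affs_cases H_cases simp: shift_hcls)

lemma shift_mult:
  assumes "\<gamma> \<in> affs" "h \<in> carrier (H_grp p)" "h' \<in> carrier (H_grp p)"
  shows "shift \<gamma> (h \<otimes>\<^bsub>H_grp p\<^esub> h') = shift \<gamma> h \<otimes>\<^bsub>H_grp p\<^esub> shift \<gamma> h'"
  using assms by (auto elim!: affs_cases H_cases simp: shift_hcls hcls_mult)

lemma shift_one: "\<gamma> \<in> affs \<Longrightarrow> shift \<gamma> \<one>\<^bsub>H_grp p\<^esub> = \<one>\<^bsub>H_grp p\<^esub>"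
  by (auto elim!: affs_cases simp: shift_hcls hcls_one)

lemma act_id [simp]: "act id h = h"
  by (simp add: act_def)

text \<open>Precomposition reverses the order of composition; this agrees with the second component
  \<open>\<delta> \<circ> \<gamma>\<close> of a product in \<open>G\<close>.\<close>

lemma shift_comp:
  assumes "\<gamma> \<in> affs" "\<delta> \<in> affs" "h \<in> carrier (H_grp p)"
  shows "shift (\<gamma> \<circ> \<delta>) h = shift \<delta> (shift \<gamma> h)"
proof -
  obtain k b l c u where "\<gamma> = aff k b" "\<delta> = aff l c" and u: "periodic u" "h = hcls u"
    using assms by (auto elim!: affs_cases H_cases)
  moreover have "shift (aff l c) (shift (aff k b) h) = hcls (\<lambda>t. u (R ^ k * (R ^ l * t + c) + b))"
    using u by (simp add: shift_hcls)
  ultimately show ?thesis by (simp add: shift_hcls aff_comp power_add algebra_simps)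
qed

section \<open>Centralizers\<close>

abbreviation G :: "((nat \<Rightarrow> int) set \<times> (nat \<Rightarrow> nat)) monoid" where
  "G \<equiv> G_grp p (aff 1 0)"

definition Stab :: "(nat \<Rightarrow> int) set \<Rightarrow> (nat \<Rightarrow> nat) set" where
  "Stab h = {\<gamma> \<in> affs. shift \<gamma> h = h}"

definition Fix :: "(nat \<Rightarrow> nat) \<Rightarrow> (nat \<Rightarrow> int) set set" where
  "Fix \<gamma> = {h \<in> carrier (H_grp p). shift \<gamma> h = h}"

definition Comm :: "(nat \<Rightarrow> nat) \<Rightarrow> (nat \<Rightarrow> nat) set" where
  "Comm \<gamma> = {\<delta> \<in> affs. \<gamma> \<circ> \<delta> = \<delta> \<circ> \<gamma>}"

lemma carrier_G: "carrier G = carrier (H_grp p) \<times> affs"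
  by (simp add: G_grp_def AB_set_eq)

lemma mult_G: "(h, \<gamma>) \<otimes>\<^bsub>G\<^esub> (h', \<delta>) = (h \<otimes>\<^bsub>H_grp p\<^esub> shift \<gamma> h', \<delta> \<circ> \<gamma>)"
  by (simp add: G_grp_def)

lemma one_G: "\<one>\<^bsub>G\<^esub> = (\<one>\<^bsub>H_grp p\<^esub>, id)"
  by (simp add: G_grp_def)

lemma id_in_affs: "id \<in> affs" using aff_in_affs[of 0 0] by (simp add: aff_0_0)

lemma card_G: "card (carrier G) = p ^ p * q"
  using p_pos by (simp add: carrier_G card_cartesian_product card_H card_affs power_minus_mult
      mult.assoc[symmetric])

lemma centralizer_G:
  "centralizer G (h, \<gamma>) = {(h', \<delta>). h' \<in> carrier (H_grp p) \<and> \<delta> \<in> Comm \<gamma> \<and>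
     h' \<otimes>\<^bsub>H_grp p\<^esub> shift \<delta> h = h \<otimes>\<^bsub>H_grp p\<^esub> shift \<gamma> h'}"
  by (auto simp: centralizer_def carrier_G mult_G Comm_def)

text \<open>\<open>H\<close> is abelian, so \<open>h'\<close> cancels from the commutation equation
  and only a condition on the permutation component remains.\<close>

lemma centralizer_of_H:
  assumes "h \<in> carrier (H_grp p)"
  shows "centralizer G (h, id) = carrier (H_grp p) \<times> Stab h"
proof -
  interpret H: comm_group "H_grp p" by (rule comm_group_H)
  have "h' \<otimes>\<^bsub>H_grp p\<^esub> shift \<delta> h = h \<otimes>\<^bsub>H_grp p\<^esub> h' \<longleftrightarrow> shift \<delta> h = h"
    if "h' \<in> carrier (H_grp p)" "\<delta> \<in> affs" for h' \<delta>
    using that assms H.m_comm[of h h'] by (simp add: shift_in)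
  then show ?thesis
    unfolding centralizer_G Comm_def Stab_def by auto
qed

text \<open>A solution is the product of \<open>shift (\<gamma> ^^ j) h\<close> over \<open>j < i\<close>.\<close>
lemma ex_commuting_lift:
  assumes \<gamma>: "\<gamma> \<in> affs" and h: "h \<in> carrier (H_grp p)"
  shows "\<gamma> ^^ i \<in> affs \<and> (\<exists>x \<in> carrier (H_grp p).
    x \<otimes>\<^bsub>H_grp p\<^esub> shift (\<gamma> ^^ i) h = h \<otimes>\<^bsub>H_grp p\<^esub> shift \<gamma> x)"
proof (induction i)
  interpret H: comm_group "H_grp p" by (rule comm_group_H)
  case 0
  have g0: "\<gamma> ^^ 0 = id" by (simp only: funpow.simps)
  show ?case using id_in_affs h
    by (intro conjI bexI[of _ "\<one>\<^bsub>H_grp p\<^esub>"]) (simp_all only: g0 inv_id act_id shift_one[OF \<gamma>] H.one_closed H.l_one H.r_one)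
next
  interpret H: comm_group "H_grp p" by (rule comm_group_H)
  case (Suc i)
  then obtain x where x: "x \<in> carrier (H_grp p)"
    "x \<otimes>\<^bsub>H_grp p\<^esub> shift (\<gamma> ^^ i) h = h \<otimes>\<^bsub>H_grp p\<^esub> shift \<gamma> x" and gi: "\<gamma> ^^ i \<in> affs"
    by blast
  have S: "\<gamma> ^^ Suc i = \<gamma> ^^ i \<circ> \<gamma>" by (rule funpow_Suc_right)
  have gS: "\<gamma> ^^ Suc i \<in> affs" unfolding S using gi \<gamma> by (auto simp: aff_comp elim!: affs_cases)
  \<comment> \<open>\<open>?y\<close> is the first component of \<open>(h, \<gamma>)\<close> times
    \<open>(x, \<gamma> ^^ i)\<close>. Started at the identity, this produces the powers of
    \<open>(h, \<gamma>)\<close>, which commute with \<open>(h, \<gamma>)\<close>.\<close>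
  let ?y = "h \<otimes>\<^bsub>H_grp p\<^esub> shift \<gamma> x"
  have "?y \<otimes>\<^bsub>H_grp p\<^esub> shift (\<gamma> ^^ Suc i) h
      = h \<otimes>\<^bsub>H_grp p\<^esub> (shift \<gamma> x \<otimes>\<^bsub>H_grp p\<^esub> shift \<gamma> (shift (\<gamma> ^^ i) h))"
    unfolding S using x(1) h \<gamma> gi by (simp only: shift_comp H.m_assoc shift_in)
  also have "\<dots> = h \<otimes>\<^bsub>H_grp p\<^esub> shift \<gamma> ?y"
    using shift_mult[OF \<gamma> x(1) shift_in[OF gi h]] x(2) by simp
  finally have "?y \<otimes>\<^bsub>H_grp p\<^esub> shift (\<gamma> ^^ Suc i) h = h \<otimes>\<^bsub>H_grp p\<^esub> shift \<gamma> ?y" .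
  moreover have "?y \<in> carrier (H_grp p)" using x h \<gamma> by (simp add: shift_in)
  ultimately show ?case using gS by blast
qed

text \<open>For each \<delta> commuting with \<gamma>, the admissible first components solve an
  inhomogeneous equation over the abelian group \<open>H\<close> whose homogeneous solutions are
  \<open>Fix \<gamma>\<close>. There is a solution because \<delta> is a power of \<gamma>, so the
  solution set \<open>F \<delta>\<close> is a coset of \<open>Fix \<gamma>\<close>.\<close>

lemma card_centralizer:
  assumes \<gamma>: "\<gamma> \<in> affs" and h: "h \<in> carrier (H_grp p)"
    and C: "Comm \<gamma> \<subseteq> range (\<lambda>i. \<gamma> ^^ i)"
  shows "card (centralizer G (h, \<gamma>)) = card (Comm \<gamma>) * card (Fix \<gamma>)"
proof -
  interpret H: comm_group "H_grp p" by (rule comm_group_H)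
  define F where "F \<delta> = {x \<in> carrier (H_grp p).
     x \<otimes>\<^bsub>H_grp p\<^esub> shift \<delta> h = h \<otimes>\<^bsub>H_grp p\<^esub> shift \<gamma> x}" for \<delta>
  have F: "card (F \<delta>) = card (Fix \<gamma>)" if \<delta>: "\<delta> \<in> Comm \<gamma>" for \<delta>
  proof -
    obtain i where i: "\<delta> = \<gamma> ^^ i" using C \<delta> by blast
    have d: "\<delta> \<in> affs" using \<delta> by (simp add: Comm_def)
    obtain x where x: "x \<in> carrier (H_grp p)"
      "x \<otimes>\<^bsub>H_grp p\<^esub> shift \<delta> h = h \<otimes>\<^bsub>H_grp p\<^esub> shift \<gamma> x"
      using ex_commuting_lift[OF \<gamma> h, of i] i by blast
    have iff: "x \<otimes>\<^bsub>H_grp p\<^esub> y \<in> F \<delta> \<longleftrightarrow> y \<in> Fix \<gamma>" if y: "y \<in> carrier (H_grp p)" for y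
    proof -
      let ?s = "shift \<gamma> y" and ?z = "h \<otimes>\<^bsub>H_grp p\<^esub> shift \<gamma> x"
      have z: "?z \<in> carrier (H_grp p)" and s: "?s \<in> carrier (H_grp p)"
        using x h y \<gamma> by (simp_all add: shift_in)
      have "(x \<otimes>\<^bsub>H_grp p\<^esub> y) \<otimes>\<^bsub>H_grp p\<^esub> shift \<delta> h = ?z \<otimes>\<^bsub>H_grp p\<^esub> y"
        unfolding x(2)[symmetric] using x(1) y shift_in[OF d h] H.m_comm[of y "shift \<delta> h"]
        by (simp only: H.m_assoc)
      moreover have "h \<otimes>\<^bsub>H_grp p\<^esub> shift \<gamma> (x \<otimes>\<^bsub>H_grp p\<^esub> y) = ?z \<otimes>\<^bsub>H_grp p\<^esub> ?s"
        using x(1) y h \<gamma> by (simp add: shift_mult H.m_assoc shift_in)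
      ultimately show ?thesis using z s y x(1) by (auto simp: F_def Fix_def)
    qed
    have "(\<lambda>y. x \<otimes>\<^bsub>H_grp p\<^esub> y) ` Fix \<gamma> = F \<delta>"
    proof (intro equalityI subsetI)
      fix w assume w: "w \<in> F \<delta>"
      then have wc: "w \<in> carrier (H_grp p)" by (simp add: F_def)
      define y where "y = inv\<^bsub>H_grp p\<^esub> x \<otimes>\<^bsub>H_grp p\<^esub> w"
      have "y \<in> carrier (H_grp p)" "w = x \<otimes>\<^bsub>H_grp p\<^esub> y"
        using x(1) wc by (simp_all add: y_def H.m_assoc[symmetric])
      then show "w \<in> (\<lambda>y. x \<otimes>\<^bsub>H_grp p\<^esub> y) ` Fix \<gamma>" using iff w by blast
    qed (use iff in \<open>auto simp: Fix_def\<close>)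
    moreover have "inj_on (\<lambda>y. x \<otimes>\<^bsub>H_grp p\<^esub> y) (Fix \<gamma>)"
      using x(1) by (auto simp: inj_on_def Fix_def)
    ultimately show ?thesis using card_image by metis
  qed
  \<comment> \<open>The permutation is the second component of an element of \<open>G\<close> but
    the index of the sum, hence \<open>prod.swap\<close>.\<close>
  have "centralizer G (h, \<gamma>) = prod.swap ` (SIGMA \<delta>:Comm \<gamma>. F \<delta>)"
    unfolding centralizer_G F_def by (auto simp: image_iff)
  then have "card (centralizer G (h, \<gamma>)) = card (SIGMA \<delta>:Comm \<gamma>. F \<delta>)"
    by (simp add: card_image)
  also have "\<dots> = (\<Sum>\<delta>\<in>Comm \<gamma>. card (F \<delta>))"
    by (rule card_SigmaI) (auto simp: F_def Comm_def finite_affs finite_H)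
  also have "\<dots> = card (Comm \<gamma>) * card (Fix \<gamma>)" using F by simp
  finally show ?thesis .
qed

lemma subgroup_Stab:
  assumes "h \<in> carrier (H_grp p)"
  shows "subgroup (Stab h) (sym_group p\<lparr>carrier := affs\<rparr>)"
proof (rule group.subgroupI)
  show "group (sym_group p\<lparr>carrier := affs\<rparr>)"
    using subgroup.subgroup_is_group[OF subgroup_affs sym_group_is_group] .
  show "Stab h \<subseteq> carrier (sym_group p\<lparr>carrier := affs\<rparr>)" by (auto simp: Stab_def)
  show "Stab h \<noteq> {}" using id_in_affs by (auto simp: Stab_def)
  fix a assume a: "a \<in> Stab h"
  then have aa: "a \<in> affs" "shift a h = h" by (simp_all add: Stab_def)
  have ai: "Hilbert_Choice.inv a \<in> affs" "bij a" using aa(1)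
    by (auto simp: inv_aff elim!: affs_cases intro: permutes_bij[OF aff_permutes])
  \<comment> \<open>By \<open>shift_comp\<close> the right side is the shift of
    \<open>shift a h\<close> by the inverse, and \<open>shift a h\<close> is
    \<open>h\<close>.\<close>
  have "shift (Hilbert_Choice.inv a) h = shift (a \<circ> Hilbert_Choice.inv a) h"
    using aa ai assms by (simp only: shift_comp)
  also have "a \<circ> Hilbert_Choice.inv a = id"
    using bij_is_surj[OF ai(2)] unfolding surj_iff .
  finally have "shift (Hilbert_Choice.inv a) h = h" by (simp only: inv_id act_id)
  with ai have "Hilbert_Choice.inv a \<in> Stab h" by (simp add: Stab_def)
  moreover have "inv\<^bsub>sym_group p\<lparr>carrier := affs\<rparr>\<^esub> a = Hilbert_Choice.inv a"
    using aa(1) subgroup_affs subgroup.mem_carrier[OF subgroup_affs]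
    by (simp add: group.m_inv_consistent[OF sym_group_is_group])
  ultimately show "inv\<^bsub>sym_group p\<lparr>carrier := affs\<rparr>\<^esub> a \<in> Stab h" by simp
  fix b assume b: "b \<in> Stab h"
  then have "shift (a \<circ> b) h = h" using a assms by (simp add: Stab_def shift_comp)
  moreover have "a \<circ> b \<in> affs" using a b by (auto simp: Stab_def aff_comp elim!: affs_cases)
  ultimately show "a \<otimes>\<^bsub>sym_group p\<lparr>carrier := affs\<rparr>\<^esub> b \<in> Stab h"
    by (simp add: Stab_def sym_group_mult)
qed

lemma card_Stab_dvd:
  assumes "h \<in> carrier (H_grp p)" shows "card (Stab h) dvd p * q"
proof -
  have "group (sym_group p\<lparr>carrier := affs\<rparr>)"
    using subgroup.subgroup_is_group[OF subgroup_affs sym_group_is_group] .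
  from group.lagrange[OF this subgroup_Stab[OF assms]]
  show ?thesis by (simp add: order_def card_affs) (metis dvd_triv_right)
qed

lemma class_size_H:
  assumes "h \<in> carrier (H_grp p)"
  shows "card (carrier G) div card (centralizer G (h, id)) = p * q div card (Stab h)"
proof -
  have "card (carrier G) = p ^ (p - 1) * (p * q)"
    using p_pos by (simp add: card_G power_minus_mult mult.assoc[symmetric])
  then show ?thesis using assms p_ge
    by (simp add: centralizer_of_H card_cartesian_product card_H)
qed

section \<open>Centralizers inside the affine group\<close>

lemma Comm_translation:
  assumes s: "\<not> [s = 0] (mod P)"
  shows "Comm (aff 0 s) \<subseteq> range (\<lambda>i. aff 0 s ^^ i)" "card (Comm (aff 0 s)) = p"
proof -
  have cs: "coprime s P" using s coprime_P_iff by simp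
  have "aff l c \<in> Comm (aff 0 s) \<longleftrightarrow> [l = 0] (mod q)" for l c
  proof -
    \<comment> \<open>The linear part of \<open>aff l c\<close> scales the step \<open>s\<close> by
      \<open>R ^ l\<close>; since \<open>s\<close> is invertible, commuting forces
      \<open>R ^ l\<close> to be 1, so only translations commute.\<close>
    have "aff l c \<in> Comm (aff 0 s) \<longleftrightarrow> [c + s = R ^ l * s + c] (mod P)"
      by (simp add: Comm_def aff_comp aff_eq_iff)
    also have "\<dots> \<longleftrightarrow> [s * 1 = s * R ^ l] (mod P)"
      by (simp add: cong_iff_dvd_diff algebra_simps)
    also have "\<dots> \<longleftrightarrow> [1 = R ^ l] (mod P)" using cs by (rule cong_mult_lcancel)
    finally show ?thesis using R_pow_one_iff cong_sym_eq by blast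
  qed
  then have iff: "aff l c \<in> Comm (aff 0 s) \<longleftrightarrow> aff l c = aff 0 (c mod P)" for l c
    by (simp add: aff_eq_iff)
  have C: "Comm (aff 0 s) = aff 0 ` {0..<P}"
  proof (intro equalityI subsetI)
    fix \<delta> assume d: "\<delta> \<in> Comm (aff 0 s)"
    then obtain l c where "\<delta> = aff l c" by (auto simp: Comm_def elim: affs_cases)
    with d iff have "\<delta> = aff 0 (c mod P)" by simp
    then show "\<delta> \<in> aff 0 ` {0..<P}" by simp
  qed (auto simp: iff)
  have "inj_on (aff 0) {0..<P}" by (auto simp: inj_on_def aff_eq_iff cong_def)
  then show "card (Comm (aff 0 s)) = p" by (simp add: C card_image)
  obtain s' where s': "[s * s' = 1] (mod P)" using cong_solve_coprime_int[OF cs] by auto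
  show "Comm (aff 0 s) \<subseteq> range (\<lambda>i. aff 0 s ^^ i)"
  proof
    fix \<gamma> assume "\<gamma> \<in> Comm (aff 0 s)"
    then obtain c where c: "\<gamma> = aff 0 c" using C by auto
    have "[c * s' mod P * s = c * s' * s] (mod P)" by (intro cong_mult cong_refl) simp
    also have "c * s' * s = c * (s * s')" by simp
    also have "[c * (s * s') = c * 1] (mod P)" by (intro cong_mult cong_refl s')
    finally have "[c = c * s' mod P * s] (mod P)" by (simp add: cong_sym_eq)
    \<comment> \<open>\<open>s'\<close> inverts \<open>s\<close>, so the translation by
      \<open>c\<close> consists of \<open>c * s'\<close> steps of length \<open>s\<close>.\<close>
    then have "\<gamma> = aff 0 s ^^ nat (c * s' mod P)"
      by (simp add: c aff_0_funpow aff_eq_iff)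
    then show "\<gamma> \<in> range (\<lambda>i. aff 0 s ^^ i)" by blast
  qed
qed

lemma R_pow_minus_one_coprime: "\<not> [k = 0] (mod q) \<Longrightarrow> coprime (R ^ k - 1) P"
  using R_pow_one_iff[of k] coprime_P_iff[of "R ^ k - 1"] by (simp add: cong_iff_dvd_diff)

lemma exponent_inverse:
  assumes "\<not> [k = 0] (mod q)" obtains x where "[k * x = 1] (mod q)"
proof -
  have "coprime k q"
    using assms q_prime by (metis cong_0_iff coprime_commute prime_imp_coprime)
  then show ?thesis using cong_solve_coprime_nat[of k q] that by (auto simp: One_nat_def)
qed

text \<open>Commuting means \<open>(R ^ k - 1) * c = (R ^ l - 1) * s\<close> modulo \<open>p\<close>
  with an invertible first factor, so \<open>l\<close> determines \<open>c\<close>. Powers of the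
  rotation realise every \<open>l\<close>, because \<open>k\<close> is invertible modulo the prime
  \<open>q\<close>.\<close>

lemma Comm_rotation:
  assumes k: "\<not> [k = 0] (mod q)"
  shows "Comm (aff k s) \<subseteq> range (\<lambda>i. aff k s ^^ i)" "card (Comm (aff k s)) = q"
proof -
  let ?\<gamma> = "aff k s"
  have uniq: "aff l c = aff l' c'"
    if "aff l c \<in> Comm ?\<gamma>" "aff l' c' \<in> Comm ?\<gamma>" "[l = l'] (mod q)" for l l' c c'
  proof -
    have *: "[(R ^ k - 1) * c = (R ^ l - 1) * s] (mod P)" if "aff l c \<in> Comm ?\<gamma>" for l c
      using that by (simp add: Comm_def aff_comp aff_eq_iff cong_iff_dvd_diff algebra_simps)
    have "[(R ^ l - 1) * s = (R ^ l' - 1) * s] (mod P)"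
      by (intro cong_mult cong_diff cong_refl) (simp add: R_pow_cong_iff that)
    then have "[(R ^ k - 1) * c = (R ^ k - 1) * c'] (mod P)"
      using *[OF that(1)] *[OF that(2)] by (metis cong_trans cong_sym)
    then have "[c = c'] (mod P)"
      using cong_mult_lcancel[OF R_pow_minus_one_coprime[OF k]] by blast
    then show ?thesis using that by (simp add: aff_eq_iff)
  qed
  have pow: "?\<gamma> ^^ i \<in> Comm ?\<gamma>" for i
  proof -
    have "?\<gamma> ^^ i \<in> affs" using aff_funpow[of i k s] by auto
    then show ?thesis by (simp add: Comm_def fun_eq_iff funpow_swap1)
  qed
  obtain x where x: "[k * x = 1] (mod q)" using exponent_inverse[OF k] .
  have C: "Comm ?\<gamma> = (\<lambda>i. ?\<gamma> ^^ i) ` {..<q}"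
  proof (intro equalityI subsetI)
    fix \<delta> assume d: "\<delta> \<in> Comm ?\<gamma>"
    then obtain l c where lc: "\<delta> = aff l c" by (auto simp: Comm_def elim: affs_cases)
    \<comment> \<open>As \<open>x\<close> inverts \<open>k\<close>, this power of the rotation has
      linear part \<open>R ^ l\<close>; by \<open>uniq\<close> it is the given element.\<close>
    define i where "i = l * x mod q"
    obtain b where b: "?\<gamma> ^^ i = aff (i * k) b" using aff_funpow by blast
    have "[i * k = l * x * k] (mod q)" unfolding i_def by (intro cong_mult cong_refl) simp
    also have "l * x * k = l * (k * x)" by simp
    also have "[l * (k * x) = l * 1] (mod q)" by (intro cong_mult cong_refl x)
    finally have "[l = i * k] (mod q)" by (simp add: cong_sym_eq)
    then have "\<delta> = ?\<gamma> ^^ i" using uniq d pow[of i] lc b by simp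
    moreover have "i < q" using q_ge by (simp add: i_def)
    ultimately show "\<delta> \<in> (\<lambda>i. ?\<gamma> ^^ i) ` {..<q}" by blast
  qed (use pow in auto)
  then show "Comm ?\<gamma> \<subseteq> range (\<lambda>i. ?\<gamma> ^^ i)" by blast
  have "inj_on (\<lambda>i. ?\<gamma> ^^ i) {..<q}"
  proof (rule inj_onI)
    fix i j assume ij: "i \<in> {..<q}" "j \<in> {..<q}" "?\<gamma> ^^ i = ?\<gamma> ^^ j"
    then have "[i * k = j * k] (mod q)"
      using aff_funpow[of i k s] aff_funpow[of j k s] by (auto simp: aff_eq_iff cong_sym_eq)
    then have "[i * k * x = j * k * x] (mod q)" by (rule cong_scalar_right)
    moreover have "[i * k * x = i] (mod q)" for i
      using cong_mult[OF cong_refl x, of i] by (simp add: mult.assoc)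
    ultimately have "[i = j] (mod q)" by (metis cong_trans cong_sym)
    then show "i = j" using ij by (simp add: cong_def)
  qed
  then show "card (Comm ?\<gamma>) = q" by (simp add: C card_image)
qed

section \<open>Fixed points\<close>

text \<open>Invariance up to a constant says that each step of length \<open>s\<close> changes
  \<open>u\<close> by the same \<open>c\<close>. These steps reach every residue, so
  \<open>u\<close> is linear with slope \<open>c\<close> divided by \<open>s\<close>, up to a
  constant.\<close>

lemma card_Fix_translation:
  assumes s: "\<not> [s = 0] (mod P)"
  shows "card (Fix (aff 0 s)) = p"
proof -
  obtain s' where s': "[s' * s = 1] (mod P)"
    using cong_solve_coprime_int[of s P] s coprime_P_iff by (auto simp: mult.commute)
  have "Fix (aff 0 s) = (\<lambda>a. hcls (\<lambda>t. a * t)) ` {0..<P}"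
  proof (intro equalityI subsetI)
    fix h assume "h \<in> Fix (aff 0 s)"
    then obtain u where u: "periodic u" "h = hcls u" "shift (aff 0 s) (hcls u) = hcls u"
      by (auto simp: Fix_def elim: H_cases)
    then have "hcls (\<lambda>t. u (R ^ 0 * t + s)) = hcls u" using shift_hcls by metis
    then obtain c where c: "\<And>t. [u (t + s) = u t + c] (mod P)"
      using u by (subst (asm) hcls_eq_iff) auto
    have mult: "[u (int n * s) = int n * c + u 0] (mod P)" for n
    proof (induction n)
      case (Suc n)
      have "[u (int n * s + s) = u (int n * s) + c] (mod P)" by (rule c)
      also have "[u (int n * s) + c = int n * c + u 0 + c] (mod P)"
        using Suc by (rule cong_add) simp
      finally show ?case by (simp add: algebra_simps)
    qed simp
    have "[u t = (s' * c mod P) * t + u 0] (mod P)" for t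
    proof -
      \<comment> \<open>The number of steps of length \<open>s\<close> that lead from 0 to
        \<open>t\<close>.\<close>
      define n where "n = nat (t * s' mod P)"
      have n: "[int n = t * s'] (mod P)" by (simp add: n_def)
      have "[int n * s = t * s' * s] (mod P)" by (rule cong_mult[OF n]) simp
      also have "[t * s' * s = t * 1] (mod P)"
        unfolding mult.assoc by (intro cong_mult cong_refl s')
      finally have "[u t = u (int n * s)] (mod P)"
        using periodicD[OF u(1)] by (simp add: cong_sym_eq)
      also note mult[of n]
      also have "[int n * c + u 0 = t * s' * c + u 0] (mod P)"
        by (intro cong_add cong_mult n cong_refl)
      also have "t * s' * c + u 0 = (s' * c) * t + u 0" by simp
      also have "[(s' * c) * t + u 0 = (s' * c mod P) * t + u 0] (mod P)"
        by (intro cong_add cong_mult cong_refl) simp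
      finally show ?thesis .
    qed
    then have "hcls u = hcls (\<lambda>t. (s' * c mod P) * t)"
      using u(1) by (subst hcls_eq_iff) auto
    then show "h \<in> (\<lambda>a. hcls (\<lambda>t. a * t)) ` {0..<P}" using u(2) by auto
  next
    fix h assume "h \<in> (\<lambda>a. hcls (\<lambda>t. a * t)) ` {0..<P}"
    then obtain a where a: "h = hcls (\<lambda>t. a * t)" by auto
    have "hcls (\<lambda>t. a * (1 * t + s)) = hcls (\<lambda>t. a * t)"
      by (subst hcls_eq_iff) (auto simp: distrib_left intro!: exI[of _ "a * s"])
    then show "h \<in> Fix (aff 0 s)" by (simp add: Fix_def a shift_hcls)
  qed
  moreover have "inj_on (\<lambda>a. hcls (\<lambda>t. a * t)) {0..<P}"
  proof (rule inj_onI)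
    fix a b assume ab: "a \<in> {0..<P}" "b \<in> {0..<P}" "hcls (\<lambda>t. a * t) = hcls (\<lambda>t. b * t)"
    then obtain c where c: "\<And>t. [a * t = b * t + c] (mod P)"
      by (subst (asm) hcls_eq_iff) auto
    have "[0 = c] (mod P)" using c[of 0] by simp
    then have "[b + 0 = b + c] (mod P)" by (intro cong_add cong_refl)
    then have "[a = b] (mod P)" using c[of 1] by (metis add.right_neutral cong_sym cong_trans mult.right_neutral)
    then show "a = b" using ab by (simp add: cong_def)
  qed
  ultimately show ?thesis by (simp add: card_image)
qed

section \<open>Squares and nonsquares as orbits of multiplication by \<open>R\<close>\<close>

definition powers :: "int set" where "powers = {t. \<exists>i. [t = R ^ i] (mod P)}"

lemma powers_cong: "[s = t] (mod P) \<Longrightarrow> s \<in> powers \<longleftrightarrow> t \<in> powers"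
  unfolding powers_def mem_Collect_eq by (meson cong_sym cong_trans)

text \<open>\<open>powers\<close> represents the subgroup of order \<open>q\<close> in the cyclic
  group of \<open>2 * q\<close> units modulo \<open>p\<close>, that is, the nonzero squares. For the
  converse, \<open>(q - 1) * k\<close> again serves as the exponent \<open>-k\<close>.\<close>

lemma powers_mult: "R ^ k * t \<in> powers \<longleftrightarrow> t \<in> powers"
proof
  assume "t \<in> powers"
  then obtain i where "[t = R ^ i] (mod P)" by (auto simp: powers_def)
  then have "[R ^ k * t = R ^ (k + i)] (mod P)" by (simp add: power_add R_pow_cancel)
  then show "R ^ k * t \<in> powers" by (auto simp: powers_def)
next
  assume "R ^ k * t \<in> powers"
  then obtain i where i: "[R ^ k * t = R ^ i] (mod P)" by (auto simp: powers_def)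
  have e: "k + (i + (q - 1) * k) = i + q * k"
    using q_ge by (cases q) (simp_all add: algebra_simps)
  have "[i + q * k = i] (mod q)" by (simp add: cong_def)
  then have "[R ^ i = R ^ k * R ^ (i + (q - 1) * k)] (mod P)"
    unfolding power_add[symmetric] e R_pow_cong_iff by (rule cong_sym)
  then have "[R ^ k * t = R ^ k * R ^ (i + (q - 1) * k)] (mod P)" using i cong_trans by blast
  then show "t \<in> powers" using R_pow_cancel by (auto simp: powers_def)
qed

lemma R_pow_not_0: "\<not> [R ^ k * t = 0] (mod P) \<longleftrightarrow> \<not> [t = 0] (mod P)"
  using R_pow_cancel[of k t 0] by simp

lemma inj_R_pow:
  assumes "\<not> [n = 0] (mod P)" shows "inj_on (\<lambda>i. R ^ i * n mod P) {..<q}"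
proof (rule inj_onI)
  fix i j assume ij: "i \<in> {..<q}" "j \<in> {..<q}" "R ^ i * n mod P = R ^ j * n mod P"
  then have "[R ^ i * n = R ^ j * n] (mod P)" by (simp add: cong_def)
  then have "[R ^ i = R ^ j] (mod P)" using assms coprime_P_iff cong_mult_rcancel by blast
  then show "i = j" using ij by (simp add: R_pow_cong_iff) (simp add: cong_def)
qed

lemma R_pow_image:
  assumes "\<not> [n = 0] (mod P)" shows "(\<lambda>i. R ^ i * n mod P) ` {..<q} \<subseteq> {1..<P}"
proof -
  have "R ^ i * n mod P \<noteq> 0" for i using R_pow_not_0 assms by (simp add: cong_def)
  moreover have "0 \<le> R ^ i * n mod P" "R ^ i * n mod P < P" for i by simp_all
  ultimately have "R ^ i * n mod P \<in> {1..<P}" for i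
    unfolding atLeastLessThan_iff by (metis int_one_le_iff_zero_less order_less_le)
  then show ?thesis by blast
qed

lemma not_one_cong_zero: "\<not> [1 = 0] (mod P)"
  using p_ge by (simp add: cong_def)

lemma R_pow_mod_in_image: "R ^ i * n mod P \<in> (\<lambda>i. R ^ i * n mod P) ` {..<q}"
proof
  have "[R ^ i = R ^ (i mod q)] (mod P)" by (simp add: R_pow_cong_iff)
  then show "R ^ i * n mod P = R ^ (i mod q) * n mod P"
    using cong_scalar_right unfolding cong_def by metis
  show "i mod q \<in> {..<q}" using q_ge by simp
qed

lemma ex_nonpower: "\<exists>n. n \<notin> powers \<and> \<not> [n = 0] (mod P)"
proof -
  let ?A = "(\<lambda>i. R ^ i * 1 mod P) ` {..<q}"
  have "card ?A = q" using inj_R_pow[OF not_one_cong_zero] by (simp add: card_image)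
  moreover have "card {1..<P} = 2 * q" using p_eq by simp
  ultimately have "?A \<noteq> {1..<P}" using q_ge by auto
  then obtain n where n: "n \<in> {1..<P}" "n \<notin> ?A" using R_pow_image[OF not_one_cong_zero] by blast
  have "n \<notin> powers"
  proof
    assume "n \<in> powers"
    then obtain i where "[n = R ^ i] (mod P)" by (auto simp: powers_def)
    then have "n = R ^ i * 1 mod P" using n(1) by (simp add: cong_def)
    then show False using n(2) R_pow_mod_in_image[of i 1] by simp
  qed
  moreover have "\<not> [n = 0] (mod P)" using n(1) by (simp add: cong_def)
  ultimately show ?thesis by blast
qed

text \<open>The powers and the multiples of \<open>n\<close> by powers are disjoint sets of
  \<open>q\<close> nonzero residues each. As \<open>p = 2 * q + 1\<close>, they exhaust the nonzero
  residues, so \<open>t\<close> lies in the second set.\<close>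

lemma nonpowers_single_orbit:
  assumes n: "n \<notin> powers" "\<not> [n = 0] (mod P)" and t: "t \<notin> powers" "\<not> [t = 0] (mod P)"
  shows "\<exists>i. [t = R ^ i * n] (mod P)"
proof -
  let ?A = "(\<lambda>i. R ^ i * 1 mod P) ` {..<q}" and ?B = "(\<lambda>i. R ^ i * n mod P) ` {..<q}"
  have sub: "?A \<union> ?B \<subseteq> {1..<P}"
    using R_pow_image[OF not_one_cong_zero] R_pow_image[OF n(2)] by blast
  have "?A \<inter> ?B = {}"
  proof (rule ccontr)
    assume "?A \<inter> ?B \<noteq> {}"
    then obtain y where y: "y \<in> ?A" "y \<in> ?B" by blast
    obtain j where j: "y = R ^ j * 1 mod P" using y(1) by (rule imageE)
    obtain i where i: "y = R ^ i * n mod P" using y(2) by (rule imageE)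
    from i j have "[R ^ i * n = R ^ j] (mod P)" by (simp add: cong_def)
    then have "R ^ i * n \<in> powers" by (auto simp: powers_def)
    then show False using n powers_mult by simp
  qed
  then have "card (?A \<union> ?B) = q + q"
    using inj_R_pow[OF not_one_cong_zero] inj_R_pow[OF n(2)] by (simp add: card_Un_disjoint card_image)
  then have "card (?A \<union> ?B) = card {1..<P}" using p_eq by simp
  then have all: "?A \<union> ?B = {1..<P}" using sub by (intro card_subset_eq) auto
  have "t mod P \<in> {1..<P}" using t(2) pos_mod_bound[OF P_pos, of t] pos_mod_sign[OF P_pos, of t]
    by (simp add: cong_def del: pos_mod_bound pos_mod_sign)
  moreover have "t mod P \<notin> ?A"
  proof
    assume "t mod P \<in> ?A"
    then obtain i where "[t = R ^ i] (mod P)" by (auto simp: cong_def)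
    then show False using t by (auto simp: powers_def)
  qed
  ultimately have "t mod P \<in> ?B" using all by blast
  then show ?thesis by (auto simp: cong_def)
qed

text \<open>Here \<open>f\<close> is the fixed residue of a rotation, and the three cases are its
  orbits. The value 0 at \<open>f\<close> selects one representative modulo constants, leaving
  \<open>a\<close> and \<open>b\<close> as coordinates.\<close>

definition orbit_fun :: "int \<Rightarrow> int \<Rightarrow> int \<Rightarrow> int \<Rightarrow> int" where
  "orbit_fun f a b t = (if [t = f] (mod P) then 0 else if t - f \<in> powers then a else b)"

lemma periodic_orbit_fun [simp]: "periodic (orbit_fun f a b)"
proof -
  have "orbit_fun f a b s = orbit_fun f a b t" if st: "[s = t] (mod P)" for s t
  proof -
    have "[s = f] (mod P) \<longleftrightarrow> [t = f] (mod P)" using st by (metis cong_sym cong_trans)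
    moreover have "s - f \<in> powers \<longleftrightarrow> t - f \<in> powers"
      by (rule powers_cong) (rule cong_diff[OF st cong_refl])
    ultimately show ?thesis by (simp add: orbit_fun_def)
  qed
  then show ?thesis by (simp add: periodic_def)
qed

text \<open>A rotation has one fixed index and two further orbits, so its fixed points in \<open>H\<close> form
  a plane: a function invariant up to a constant is invariant, by evaluation at the fixed index.\<close>
lemma card_Fix_rotation:
  assumes k: "\<not> [k = 0] (mod q)"
  shows "card (Fix (aff k s)) = p * p"
proof -
  obtain z where z: "[(R ^ k - 1) * z = 1] (mod P)"
    using cong_solve_coprime_int[OF R_pow_minus_one_coprime[OF k]] by auto
  \<comment> \<open>The solution of \<open>R ^ k * f + s = f\<close> modulo \<open>p\<close>, with
    \<open>z\<close> the inverse of \<open>R ^ k - 1\<close>.\<close>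
  define f where "f = - (z * s)"
  have "[(R ^ k - 1) * z * s = 1 * s] (mod P)" using z by (rule cong_scalar_right)
  then have f: "[R ^ k * f + s = f] (mod P)"
    unfolding f_def by (simp add: cong_iff_dvd_diff algebra_simps dvd_diff_commute)
  \<comment> \<open>Measured from \<open>f\<close>, the rotation is multiplication by
    \<open>R ^ k\<close>.\<close>
  have shift_f: "[R ^ k * t + s - f = R ^ k * (t - f)] (mod P)" for t
    using cong_add[OF cong_refl f, of "R ^ k * t - R ^ k * f - f"] by (simp add: algebra_simps)
  obtain n where n: "n \<notin> powers" "\<not> [n = 0] (mod P)" using ex_nonpower by blast
  obtain x where x: "[k * x = 1] (mod q)" using exponent_inverse[OF k] .
  let ?W = "\<lambda>(a, b). hcls (orbit_fun f a b)"
  \<comment> \<open>The residues \<open>f\<close>, \<open>1 + f\<close> and \<open>n + f\<close>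
    represent the three orbits, so evaluation there reads off \<open>a\<close> and
    \<open>b\<close>.\<close>
  have val: "orbit_fun f a b f = 0" "orbit_fun f a b (1 + f) = a" "orbit_fun f a b (n + f) = b"
    for a b
  proof -
    have "1 \<in> powers" unfolding powers_def by (auto intro!: exI[of _ 0])
    moreover have "\<not> [t + f = f] (mod P)" if "\<not> [t = 0] (mod P)" for t
      using that by (simp add: cong_iff_dvd_diff)
    ultimately show "orbit_fun f a b f = 0" "orbit_fun f a b (1 + f) = a"
      "orbit_fun f a b (n + f) = b"
      using n not_one_cong_zero by (simp_all add: orbit_fun_def)
  qed
  have inj: "inj_on ?W ({0..<P} \<times> {0..<P})"
  proof (rule inj_onI, clarify)
    fix a b a' b' assume r: "a \<in> {0..<P}" "b \<in> {0..<P}" "a' \<in> {0..<P}" "b' \<in> {0..<P}"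
      and "hcls (orbit_fun f a b) = hcls (orbit_fun f a' b')"
    then obtain c where c: "\<And>t. [orbit_fun f a b t = orbit_fun f a' b' t + c] (mod P)"
      by (subst (asm) hcls_eq_iff) auto
    have c0: "[0 = c] (mod P)" using c[of f] by (simp add: val)
    have "[a = a' + c] (mod P)" "[b = b' + c] (mod P)"
      using c[of "1 + f"] c[of "n + f"] by (simp_all only: val)
    moreover have "[d + c = d] (mod P)" for d using c0 by (simp add: cong_iff_dvd_diff)
    ultimately have "[a = a'] (mod P)" "[b = b'] (mod P)" using cong_trans by blast+
    then show "a = a' \<and> b = b'" using r by (simp add: cong_def)
  qed
  have "Fix (aff k s) = ?W ` ({0..<P} \<times> {0..<P})"
  proof (intro equalityI subsetI)
    fix h assume "h \<in> Fix (aff k s)"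
    then obtain u where u: "periodic u" "h = hcls u" "shift (aff k s) (hcls u) = hcls u"
      by (auto simp: Fix_def elim: H_cases)
    then have "hcls (\<lambda>t. u (R ^ k * t + s)) = hcls u" using shift_hcls by metis
    then obtain c where c: "\<And>t. [u (R ^ k * t + s) = u t + c] (mod P)"
      using u by (subst (asm) hcls_eq_iff) auto
    have "[u f = u f + c] (mod P)"
      using periodicD[OF u(1) f] c[of f] by (metis cong_sym cong_trans)
    then have c0: "[u t + c = u t] (mod P)" for t by (simp add: cong_iff_dvd_diff)
    have rot: "[u (R ^ k * t + f) = u (t + f)] (mod P)" for t
    proof -
      have "[R ^ k * t + f = R ^ k * (t + f) + s] (mod P)"
        using cong_add[OF cong_refl shift_f[of "t + f"], of f] by (simp add: cong_sym_eq add.commute)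
      then have "[u (R ^ k * t + f) = u (R ^ k * (t + f) + s)] (mod P)" by (rule periodicD[OF u(1)])
      also note c also note c0
      finally show ?thesis .
    qed
    have rots: "[u (R ^ (k * i) * t + f) = u (t + f)] (mod P)" for i t
    proof (induction i)
      case (Suc i)
      have "R ^ (k * Suc i) * t + f = R ^ k * (R ^ (k * i) * t) + f"
        by (simp add: power_add algebra_simps)
      then show ?case using rot[of "R ^ (k * i) * t"] Suc cong_trans by metis
    qed simp
    \<comment> \<open>The exponent \<open>k\<close> is invertible modulo \<open>q\<close>, so
      iterating this one rotation realises multiplication by every power of \<open>R\<close> around
      \<open>f\<close>.\<close>
    have orb: "[u (t + f) = u (m + f)] (mod P)" if "[t = R ^ i * m] (mod P)" for t m i
    proof -
      have "[i * (k * x) = i * 1] (mod q)" by (intro cong_mult cong_refl x)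
      then have "[R ^ i = R ^ (k * (x * i))] (mod P)"
        by (simp add: R_pow_cong_iff cong_sym_eq algebra_simps)
      then have "[R ^ i * m = R ^ (k * (x * i)) * m] (mod P)" by (rule cong_scalar_right)
      then have "[t = R ^ (k * (x * i)) * m] (mod P)" using that cong_trans by blast
      then have "[t + f = R ^ (k * (x * i)) * m + f] (mod P)" by (intro cong_add cong_refl)
      then have "[u (t + f) = u (R ^ (k * (x * i)) * m + f)] (mod P)" by (rule periodicD[OF u(1)])
      then show ?thesis using rots cong_trans by blast
    qed
    have both: "[x = z] (mod P) \<Longrightarrow> [y = z] (mod P) \<Longrightarrow> [x = y] (mod P)" for x y z
      by (metis cong_sym cong_trans)
    define a b where "a = (u (1 + f) - u f) mod P" and "b = (u (n + f) - u f) mod P"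
    have "[u t = orbit_fun f a b t + u f] (mod P)" for t
    proof -
      consider "[t = f] (mod P)" | "\<not> [t = f] (mod P)" "t - f \<in> powers"
        | "\<not> [t = f] (mod P)" "t - f \<notin> powers" by blast
      then show ?thesis
      proof cases
        case 1 then show ?thesis using periodicD[OF u(1)] by (simp add: orbit_fun_def)
      next
        case 2
        then obtain i where "[t - f = R ^ i * 1] (mod P)" by (auto simp: powers_def)
        then have "[u t = u (1 + f)] (mod P)" using orb[of "t - f" i 1] by simp
        moreover have "[a + u f = u (1 + f)] (mod P)"
          unfolding a_def by (simp add: cong_def mod_simps)
        ultimately have "[u t = a + u f] (mod P)" by (rule both)
        then show ?thesis using 2 by (simp add: orbit_fun_def)
      next
        case 3
        then have "\<not> [t - f = 0] (mod P)" by (simp add: cong_iff_dvd_diff)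
        then obtain i where "[t - f = R ^ i * n] (mod P)"
          using nonpowers_single_orbit n 3 by blast
        then have "[u t = u (n + f)] (mod P)" using orb[of "t - f" i n] by simp
        moreover have "[b + u f = u (n + f)] (mod P)"
          unfolding b_def by (simp add: cong_def mod_simps)
        ultimately have "[u t = b + u f] (mod P)" by (rule both)
        then show ?thesis using 3 by (simp add: orbit_fun_def)
      qed
    qed
    then have "hcls u = hcls (orbit_fun f a b)" using u(1) by (subst hcls_eq_iff) auto
    moreover have "(a, b) \<in> {0..<P} \<times> {0..<P}" by (simp add: a_def b_def)
    ultimately show "h \<in> ?W ` ({0..<P} \<times> {0..<P})" using u(2) by force
  next
    fix h assume "h \<in> ?W ` ({0..<P} \<times> {0..<P})"
    then obtain a b where h: "h = hcls (orbit_fun f a b)" by auto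
    \<comment> \<open>Multiplication by \<open>R ^ k\<close> around \<open>f\<close> preserves each
      of the three cases, so here invariance is exact.\<close>
    have "orbit_fun f a b (R ^ k * t + s) = orbit_fun f a b t" for t
    proof -
      have "[R ^ k * t + s = f] (mod P) \<longleftrightarrow> [R ^ k * t + s - f = 0] (mod P)"
        by (simp add: cong_iff_dvd_diff)
      also have "\<dots> \<longleftrightarrow> [R ^ k * (t - f) = 0] (mod P)"
        using shift_f[of t] by (metis cong_sym cong_trans)
      also have "\<dots> \<longleftrightarrow> [t - f = 0] (mod P)" using R_pow_not_0 by blast
      also have "\<dots> \<longleftrightarrow> [t = f] (mod P)" by (simp add: cong_iff_dvd_diff)
      finally show ?thesis
        using powers_cong[OF shift_f[of t]] powers_mult by (simp add: orbit_fun_def)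
    qed
    then show "h \<in> Fix (aff k s)" by (simp add: Fix_def h shift_hcls)
  qed
  then show ?thesis using inj by (simp add: card_image)
qed

section \<open>Stabilisers and class sizes\<close>

lemma Stab_one: "Stab (hcls (\<lambda>_. 0)) = affs"
  by (auto simp: Stab_def shift_hcls elim: affs_cases)

lemma aff_in_Stab_iff:
  assumes "periodic u"
  shows "aff k b \<in> Stab (hcls u) \<longleftrightarrow> (\<exists>c. \<forall>t. [u (R ^ k * t + b) = u t + c] (mod P))"
proof -
  have "aff k b \<in> Stab (hcls u) \<longleftrightarrow> hcls (\<lambda>t. u (R ^ k * t + b)) = hcls u"
    using aff_in_affs shift_hcls[OF assms] unfolding Stab_def by auto
  then show ?thesis unfolding hcls_eq_iff[OF periodic_intros(5)[OF assms] assms] .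
qed

text \<open>Precomposition changes the slope 1 into \<open>R ^ k\<close> and otherwise adds a
  constant, so exactly the translations fix this class. The factor 1 keeps the shape
  \<open>a * t\<close> for which periodicity is proved.\<close>

lemma card_Stab_linear: "card (Stab (hcls (\<lambda>t. 1 * t))) = p"
proof -
  have "aff k b \<in> Stab (hcls (\<lambda>t. 1 * t)) \<longleftrightarrow> [k = 0] (mod q)" for k b
  proof -
    have "[k = 0] (mod q)" if c: "\<forall>t. [1 * (R ^ k * t + b) = 1 * t + c] (mod P)" for c
    proof -
      have "[b = c] (mod P)" "[R ^ k + b = 1 + c] (mod P)" using c[rule_format, of 0] c[rule_format, of 1] by simp_all
      then have "[R ^ k + b - b = 1 + c - c] (mod P)" by (intro cong_diff)
      then show ?thesis using R_pow_one_iff by simp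
    qed
    moreover have "[R ^ k * t + b = t + b] (mod P)" if "[k = 0] (mod q)" for t
    proof -
      have "[R ^ k * t + b = 1 * t + b] (mod P)"
        using that by (intro cong_add cong_mult cong_refl) (simp add: R_pow_one_iff)
      then show ?thesis by simp
    qed
    ultimately show ?thesis unfolding aff_in_Stab_iff[OF periodic_intros(2)[of 1]]
      by auto
  qed
  then have iff: "aff k b \<in> Stab (hcls (\<lambda>t. 1 * t)) \<longleftrightarrow> aff k b = aff 0 (b mod P)" for k b
    by (simp add: aff_eq_iff)
  have "Stab (hcls (\<lambda>t. 1 * t)) = aff 0 ` {0..<P}"
  proof (intro equalityI subsetI)
    fix \<delta> assume d: "\<delta> \<in> Stab (hcls (\<lambda>t. 1 * t))"
    then obtain l c where "\<delta> = aff l c" by (auto simp: Stab_def elim: affs_cases)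
    with d iff have "\<delta> = aff 0 (c mod P)" by simp
    then show "\<delta> \<in> aff 0 ` {0..<P}" by simp
  qed (use iff in auto)
  moreover have "inj_on (aff 0) {0..<P}" by (auto simp: inj_on_def aff_eq_iff cong_def)
  ultimately show ?thesis by (simp add: card_image)
qed

text \<open>For \<open>e = 0\<close> only the residue 0 is marked, leaving the multiplications as
  stabiliser; for \<open>e = 2\<close> the residues 0 and 1 carry different marks, so an affine map
  in the stabiliser fixes both.\<close>

definition spike :: "int \<Rightarrow> int \<Rightarrow> int" where
  "spike e t = (if [t = 0] (mod P) then 1 else if [t = 1] (mod P) then e else 0)"

lemma periodic_spike [simp]: "periodic (spike e)"
proof -
  have "[s = c] (mod P) \<longleftrightarrow> [t = c] (mod P)" if "[s = t] (mod P)" for s t c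
    using that by (metis cong_sym cong_trans)
  then have "spike e s = spike e t" if "[s = t] (mod P)" for s t
    using that by (simp add: spike_def)
  then show ?thesis by (simp add: periodic_def)
qed

lemma small_cong_iff: "0 \<le> a \<Longrightarrow> a < 7 \<Longrightarrow> 0 \<le> b \<Longrightarrow> b < 7 \<Longrightarrow> [a = b] (mod P) \<longleftrightarrow> a = b"
  using p_ge by (simp add: cong_def)

text \<open>Among the residues 2, 3, 4 one is mapped outside \<open>{0, 1}\<close>, and there the spike function
  vanishes on both sides; so invariance up to a constant is invariance.\<close>
lemma aff_in_Stab_spike:
  "aff k b \<in> Stab (hcls (spike e)) \<longleftrightarrow> (\<forall>t. [spike e (R ^ k * t + b) = spike e t] (mod P))"
proof
  assume "aff k b \<in> Stab (hcls (spike e))"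
  then obtain c where c: "\<And>t. [spike e (R ^ k * t + b) = spike e t + c] (mod P)"
    by (auto simp: aff_in_Stab_iff)
  let ?g = "\<lambda>t. R ^ k * t + b"
  have g_inj: "[s = t] (mod P)" if "[?g s = ?g t] (mod P)" for s t
    using that R_pow_cancel[of k s t] by (simp add: cong_iff_dvd_diff)
  have "\<exists>t \<in> {2, 3, 4}. \<not> [?g t = 0] (mod P) \<and> \<not> [?g t = 1] (mod P)"
  proof (rule ccontr)
    assume "\<not> ?thesis"
    then have *: "[?g t = 0] (mod P) \<or> [?g t = 1] (mod P)" if "t \<in> {2, 3, 4}" for t
      using that by blast
    have both: "[x = z] (mod P) \<Longrightarrow> [y = z] (mod P) \<Longrightarrow> [x = y] (mod P)" for x y z
      by (metis cong_sym cong_trans)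
    \<comment> \<open>Pigeonhole: three residues would be mapped to two values.\<close>
    have "[?g 2 = ?g 3] (mod P) \<or> [?g 2 = ?g 4] (mod P) \<or> [?g 3 = ?g 4] (mod P)"
      using *[of 2, simplified] *[of 3, simplified] *[of 4, simplified] both by blast
    then have "[2 = 3] (mod P) \<or> [2 = 4] (mod P) \<or> [3 = 4] (mod P)" using g_inj by blast
    then show False by (simp add: small_cong_iff)
  qed
  then obtain t where t: "t \<in> {2, 3, 4}" "\<not> [?g t = 0] (mod P)" "\<not> [?g t = 1] (mod P)" by blast
  then have "spike e t = 0" "spike e (?g t) = 0" by (auto simp: spike_def small_cong_iff)
  then have "[0 = c] (mod P)" using c[of t] by simp
  then have "[spike e s + c = spike e s] (mod P)" for s by (simp add: cong_iff_dvd_diff)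
  then show "\<forall>t. [spike e (R ^ k * t + b) = spike e t] (mod P)" using c cong_trans by blast
next
  assume *: "\<forall>t. [spike e (R ^ k * t + b) = spike e t] (mod P)"
  then show "aff k b \<in> Stab (hcls (spike e))" by (auto simp: aff_in_Stab_iff intro!: exI[of _ 0])
qed

lemma spike_cong_one_iff: "e \<in> {0, 2} \<Longrightarrow> [spike e t = 1] (mod P) \<longleftrightarrow> [t = 0] (mod P)"
  by (auto simp: spike_def small_cong_iff)

lemma spike_cong_two_iff: "[spike 2 t = 2] (mod P) \<longleftrightarrow> [t = 1] (mod P)"
proof -
  have "\<not> ([t = 0] (mod P) \<and> [t = 1] (mod P))"
    using not_one_cong_zero by (metis cong_sym cong_trans)
  then show ?thesis by (auto simp: spike_def small_cong_iff)
qed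

text \<open>The value 1 is taken only at the residue 0, so the map fixes 0, and its value there is
  \<open>b\<close>.\<close>

lemma Stab_spike_translation:
  assumes "aff k b \<in> Stab (hcls (spike e))" "e \<in> {0, 2}" shows "[b = 0] (mod P)"
proof -
  have "[spike e b = spike e 0] (mod P)" using assms(1) by (auto simp: aff_in_Stab_spike dest: spec[of _ 0])
  then have "[spike e b = 1] (mod P)" by (simp add: spike_def)
  then show ?thesis using assms(2) spike_cong_one_iff by blast
qed

lemma card_Stab_spike_0: "card (Stab (hcls (spike 0))) = q"
proof -
  have "aff k 0 \<in> Stab (hcls (spike 0))" for k
    unfolding aff_in_Stab_spike using R_pow_not_0[of k] by (auto simp: spike_def)
  moreover have "\<exists>k. k < q \<and> \<gamma> = aff k 0" if "\<gamma> \<in> Stab (hcls (spike 0))" for \<gamma>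
  proof -
    obtain k b where g: "\<gamma> = aff k b" using \<open>\<gamma> \<in> _\<close> by (auto simp: Stab_def elim: affs_cases)
    then have "\<gamma> = aff (k mod q) 0" using that Stab_spike_translation by (auto simp: aff_eq_iff)
    then show ?thesis using q_ge by (intro exI[of _ "k mod q"]) simp
  qed
  ultimately have "Stab (hcls (spike 0)) = (\<lambda>k. aff k 0) ` {..<q}" by auto
  moreover have "inj_on (\<lambda>k. aff k 0) {..<q}" by (auto simp: inj_on_def aff_eq_iff cong_def)
  ultimately show ?thesis by (simp add: card_image)
qed

text \<open>The residue 1 is the only one with value 2, so it is fixed along with 0; an affine map
  fixing both is the identity.\<close>

lemma Stab_spike_2: "Stab (hcls (spike 2)) = {id}"
proof
  show "Stab (hcls (spike 2)) \<subseteq> {id}"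
  proof
    fix \<gamma> assume g: "\<gamma> \<in> Stab (hcls (spike 2))"
    then obtain k b where kb: "\<gamma> = aff k b" by (auto simp: Stab_def elim: affs_cases)
    have b: "[b = 0] (mod P)" using g kb Stab_spike_translation by blast
    have "[spike 2 (R ^ k * 1 + b) = spike 2 1] (mod P)" using g kb aff_in_Stab_spike by blast
    then have "[R ^ k + b = 1] (mod P)"
      using not_one_cong_zero by (simp add: spike_cong_two_iff[symmetric] spike_def)
    then have "[R ^ k + b - b = 1 - 0] (mod P)" using b by (rule cong_diff)
    then have "\<gamma> = aff 0 0" using kb b by (simp add: aff_eq_iff R_pow_one_iff)
    then show "\<gamma> \<in> {id}" by (simp add: aff_0_0)
  qed
  show "{id} \<subseteq> Stab (hcls (spike 2))" using id_in_affs by (simp add: Stab_def)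
qed

section \<open>Class sizes of the elements of \<open>G\<close>\<close>

lemma p_power_split: "p ^ p = p ^ (p - 2) * (p * p)"
proof -
  have "(p - 2) + 2 = p" using p_ge by simp
  moreover have "p ^ ((p - 2) + 2) = p ^ (p - 2) * (p * p)"
    by (simp only: power_add power2_eq_square)
  ultimately show ?thesis by (simp only:)
qed

lemma class_size_translation:
  assumes "\<not> [s = 0] (mod P)" "h \<in> carrier (H_grp p)"
  shows "card (carrier G) div card (centralizer G (h, aff 0 s)) = p ^ (p - 2) * q"
proof -
  \<comment> \<open>One factor \<open>p\<close> counts the commuting translations, the other the
    linear fixed points.\<close>
  have "card (centralizer G (h, aff 0 s)) = p * p"
    using card_centralizer[OF aff_in_affs assms(2) Comm_translation(1)] assms(1)
    by (simp add: Comm_translation(2) card_Fix_translation)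
  moreover have "card (carrier G) = p ^ (p - 2) * q * (p * p)"
    unfolding card_G p_power_split by simp
  ultimately show ?thesis using p_ge by simp
qed

lemma class_size_rotation:
  assumes "\<not> [k = 0] (mod q)" "h \<in> carrier (H_grp p)"
  shows "card (carrier G) div card (centralizer G (h, aff k s)) = p ^ (p - 2)"
proof -
  \<comment> \<open>\<open>q\<close> counts the powers of the rotation, and \<open>p * p\<close> the
    functions constant on its three orbits.\<close>
  have "card (centralizer G (h, aff k s)) = q * (p * p)"
    using card_centralizer[OF aff_in_affs assms(2) Comm_rotation(1)] assms(1)
    by (simp add: Comm_rotation(2) card_Fix_rotation)
  moreover have "card (carrier G) = p ^ (p - 2) * (q * (p * p))"
    unfolding card_G p_power_split by simp
  ultimately show ?thesis using p_ge q_ge by simp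
qed

lemma dvd_prime_product_quotient:
  assumes "d dvd p * q" shows "p * q div d \<in> {1, p, q, p * q}"
proof -
  obtain e where e: "p * q = d * e" using assms by (elim dvdE)
  then have "e dvd p * q" "d > 0" using p_ge q_ge by (auto intro: Nat.gr0I)
  then obtain x y where xy: "e = x * y" "x dvd p" "y dvd q" using division_decomp by blast
  then have "x \<in> {1, p}" "y \<in> {1, q}" using p_prime q_prime by (auto simp: prime_nat_iff)
  moreover have "p * q div d = e" using e \<open>d > 0\<close> by simp
  ultimately show ?thesis using xy(1) by auto
qed

lemma class_sizes_G: "class_sizes G = set_times {1, p, p ^ (p - 2)} {1, q}"
proof -
  let ?cs = "\<lambda>x. card (carrier G) div card (centralizer G x)"
  have T: "set_times {1, p, p ^ (p - 2)} {1, q}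
      = {1, p, q, p * q, p ^ (p - 2), p ^ (p - 2) * q}"
  proof -
    have "set_times A D = (\<Union>d\<in>D. (\<lambda>w. w * d) ` A)" for A D by (auto simp: set_times_def)
    then show ?thesis by auto
  qed
  have "?cs (h, \<gamma>) \<in> {1, p, q, p * q, p ^ (p - 2), p ^ (p - 2) * q}"
    if h: "h \<in> carrier (H_grp p)" and "\<gamma> \<in> affs" for h \<gamma>
  proof -
    obtain k s where ks: "\<gamma> = aff k s" using \<open>\<gamma> \<in> affs\<close> by (rule affs_cases)
    \<comment> \<open>The permutation component is a rotation, a nontrivial translation or the
      identity.\<close>
    consider "\<not> [k = 0] (mod q)" | "\<gamma> = aff 0 s" "\<not> [s = 0] (mod P)" | "\<gamma> = id"
      using ks aff_eq_iff[of k s] by (auto simp flip: aff_0_0)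
    then show ?thesis
    proof cases
      case 1 then show ?thesis using class_size_rotation[OF 1 h] ks by simp
    next
      case 2 then show ?thesis using class_size_translation[OF 2(2) h] by simp
    next
      case 3 then show ?thesis
        using class_size_H[OF h] dvd_prime_product_quotient[OF card_Stab_dvd[OF h]] by auto
    qed
  qed
  then have "class_sizes G \<subseteq> {1, p, q, p * q, p ^ (p - 2), p ^ (p - 2) * q}"
    unfolding class_sizes_def carrier_G by blast
  moreover
  have mem: "?cs (hcls u, \<gamma>) \<in> class_sizes G" if "\<gamma> \<in> affs" for u \<gamma>
  proof -
    have "(hcls u, \<gamma>) \<in> carrier G" using that by (simp add: carrier_G)
    then show ?thesis unfolding class_sizes_def by blast
  qed
  have memH: "p * q div card (Stab (hcls u)) \<in> class_sizes G" for u
    using mem[OF id_in_affs, of u] class_size_H[of "hcls u"] by simp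
  \<comment> \<open>The stabilisers of these four functions have orders \<open>p * q\<close>,
    \<open>p\<close>, \<open>q\<close> and 1, giving the class sizes 1, \<open>q\<close>,
    \<open>p\<close> and \<open>p * q\<close> in turn.\<close>
  have "1 \<in> class_sizes G" "q \<in> class_sizes G" "p \<in> class_sizes G" "p * q \<in> class_sizes G"
    using memH[of "\<lambda>_. 0"] memH[of "\<lambda>t. 1 * t"] memH[of "spike 0"] memH[of "spike 2"] p_ge q_ge
    unfolding Stab_one card_affs card_Stab_linear card_Stab_spike_0 Stab_spike_2 by simp_all
  moreover have "p ^ (p - 2) * q \<in> class_sizes G"
    using mem[of "aff 0 1" "\<lambda>_. 0"] class_size_translation[OF not_one_cong_zero] by simp
  moreover have "\<not> [1 = 0] (mod q)" using q_ge by (simp add: cong_def)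
  then have "p ^ (p - 2) \<in> class_sizes G"
    using mem[of "aff 1 0" "\<lambda>_. 0"] class_size_rotation[of 1] by simp
  ultimately show ?thesis
    unfolding T by (intro equalityI) (simp_all only: insert_subset empty_subsetI simp_thms)
qed

section \<open>The center of \<open>G\<close>\<close>

lemma center_G: "center G = {\<one>\<^bsub>G\<^esub>}"
proof
  interpret H: comm_group "H_grp p" by (rule comm_group_H)
  show "{\<one>\<^bsub>G\<^esub>} \<subseteq> center G"
    using id_in_affs by (auto simp: center_def carrier_G one_G mult_G shift_one)
  show "center G \<subseteq> {\<one>\<^bsub>G\<^esub>}"
  proof
    fix z assume "z \<in> center G"
    then obtain h \<gamma> where z: "z = (h, \<gamma>)" "h \<in> carrier (H_grp p)" "\<gamma> \<in> affs"
      and cent: "\<And>g. g \<in> carrier G \<Longrightarrow> (h, \<gamma>) \<otimes>\<^bsub>G\<^esub> g = g \<otimes>\<^bsub>G\<^esub> (h, \<gamma>)"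
      by (auto simp: center_def carrier_G)
    obtain k s where ks: "\<gamma> = aff k s" using z(3) by (rule affs_cases)
    obtain u where u: "periodic u" "h = hcls u" using z(2) by (rule H_cases)
    \<comment> \<open>Testing against pure permutations shows that \<gamma> is central among the
      affine maps and that all of them fix \<open>h\<close>.\<close>
    have comm: "\<delta> \<circ> \<gamma> = \<gamma> \<circ> \<delta>" and fix_h: "h = shift \<delta> h" if "\<delta> \<in> affs" for \<delta>
    proof -
      have "(\<one>\<^bsub>H_grp p\<^esub>, \<delta>) \<in> carrier G" using that by (simp add: carrier_G)
      from cent[OF this] show "\<delta> \<circ> \<gamma> = \<gamma> \<circ> \<delta>" "h = shift \<delta> h"
        using z that by (simp_all add: mult_G shift_one shift_in)
    qed
    \<comment> \<open>Commuting with \<beta> gives the first congruence, commuting with \<alpha> the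
      second; as \<open>R - 1\<close> is invertible, both parts of \<gamma> are trivial.\<close>
    have "[s = R * s] (mod P)" "[R ^ k = 1] (mod P)"
      using comm[of "aff 1 0"] comm[of "aff 0 1"]
      by (simp_all add: ks aff_comp aff_eq_iff cong_sym_eq cong_iff_dvd_diff)
    then have "[(R - 1) * s = (R - 1) * 0] (mod P)" and k: "[k = 0] (mod q)"
      by (simp add: cong_iff_dvd_diff algebra_simps dvd_diff_commute, simp only: R_pow_one_iff)
    moreover have R1: "coprime (R - 1) P"
      using R_pow_minus_one_coprime[of 1] q_ge by (simp add: cong_def)
    ultimately have "[s = 0] (mod P)" using cong_mult_lcancel by blast
    then have "\<gamma> = id" using k ks by (simp add: aff_eq_iff flip: aff_0_0)
    moreover have "h = \<one>\<^bsub>H_grp p\<^esub>"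
    proof -
      have "aff 0 1 \<in> Stab (hcls u)" "aff 1 0 \<in> Stab (hcls u)"
        using fix_h u by (auto simp: Stab_def)
      then obtain c d where c: "\<And>t. [u (t + 1) = u t + c] (mod P)"
        and d: "\<And>t. [u (R * t) = u t + d] (mod P)"
        by (auto simp: aff_in_Stab_iff[OF u(1)])
      \<comment> \<open>Invariance under \<alpha> makes \<open>u\<close> linear with slope
        \<open>c\<close>. Invariance under \<beta> will give equal values at 1 and \<open>R\<close>,
        hence \<open>(R - 1) * c = 0\<close> modulo \<open>p\<close> and slope 0.\<close>
      have lin: "[u (int n) = u 0 + int n * c] (mod P)" for n
      proof (induction n)
        case (Suc n)
        have "[u (int n + 1) = u (int n) + c] (mod P)" by (rule c)
        also have "[u (int n) + c = u 0 + int n * c + c] (mod P)"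
          using Suc by (rule cong_add) simp
        finally show ?case by (simp add: algebra_simps)
      qed simp
      have "[d = 0] (mod P)" using d[of 0] by (simp add: cong_iff_dvd_diff)
      then have "[u 1 + d = u 1 + 0] (mod P)" by (intro cong_add cong_refl)
      then have "[u R = u 1] (mod P)" using d[of 1] cong_trans by auto
      then have "[u 0 + R * c = u 0 + 1 * c] (mod P)"
        using lin[of r] lin[of 1] by (metis cong_sym cong_trans of_nat_1)
      then have "[(R - 1) * c = (R - 1) * 0] (mod P)"
        by (simp add: cong_iff_dvd_diff algebra_simps)
      then have c0: "[c = 0] (mod P)" using R1 cong_mult_lcancel by blast
      have "[u t = 0 + u 0] (mod P)" for t
      proof -
        have "[u t = u (int (nat (t mod P)))] (mod P)" by (rule periodicD[OF u(1)]) simp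
        also note lin
        also have "[u 0 + int (nat (t mod P)) * c = u 0 + int (nat (t mod P)) * 0] (mod P)"
          by (intro cong_add cong_mult cong_refl c0)
        finally show ?thesis by simp
      qed
      then have "hcls u = hcls (\<lambda>_. 0)" using u(1) by (subst hcls_eq_iff) auto
      then show ?thesis using u(2) by (simp add: hcls_one)
    qed
    ultimately show "z \<in> {\<one>\<^bsub>G\<^esub>}" using z(1) by (simp add: one_G)
  qed
qed

end

section \<open>Recovering \<beta> from its conjugation of \<alpha>\<close>

theorem theorem1:
  fixes p q :: nat and \<beta> :: "nat \<Rightarrow> nat" and ms ns :: "nat list"
  assumes "Factorial_Ring.prime p" and "Factorial_Ring.prime q" and "p = 2 * q + 1"
    and "length ms = q" and "length ns = q"
    and "distinct (ms @ ns)" and "set (ms @ ns) = {2..p}"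
    and "\<beta> = cycle_of_list ms \<circ> cycle_of_list ns"
    and "\<exists>r::nat. 1 < r \<and> r < q \<and> [r ^ q = 1] (mod p)
           \<and> \<beta> \<circ> alpha_perm p \<circ> Hilbert_Choice.inv \<beta> = alpha_perm p ^^ r"
  shows "class_sizes (G_grp p \<beta>) = set_times {1, p, p ^ (p - 2)} {1, q}
           \<and> center (G_grp p \<beta>) = {\<one>\<^bsub>G_grp p \<beta>\<^esub>}"
proof -
  obtain r where r: "1 < r" "r < q" "[r ^ q = 1] (mod p)"
    "\<beta> \<circ> alpha_perm p \<circ> Hilbert_Choice.inv \<beta> = alpha_perm p ^^ r"
    using assms(9) by blast
  interpret affine_data p q r by unfold_locales (use assms r in auto)
  \<comment> \<open>The cycles move only \<open>{2..p}\<close>; in particular \<beta> fixes the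
    index 1, which is the residue 0.\<close>
  have outside: "\<beta> i = i" if "i \<notin> {2..p}" for i
  proof -
    have "i \<notin> set ms" "i \<notin> set ns" using that unfolding assms(7)[symmetric] by simp_all
    then show ?thesis by (simp add: assms(8) id_outside_supp)
  qed
  have "bij \<beta>" unfolding assms(8)
    by (intro bij_comp permutation_bijective permutation_of_cycle)
  \<comment> \<open>For permutations acting on the right,
    \<open>\<beta> \<circ> alpha_perm p \<circ> inv \<beta>\<close> is the conjugate of \<alpha> by
    \<beta>; cancelling the inverse leaves a recursion for \<beta> along the cycle of
    \<alpha>.\<close>
  then have "\<beta> \<circ> alpha_perm p = alpha_perm p ^^ r \<circ> \<beta>"
    using r(4) by (metis bij_is_inj comp_assoc comp_id inv_o_cancel)
  then have conj: "\<beta> (aff 0 1 i) = aff 0 R (\<beta> i)" for i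
    by (simp add: alpha_perm_eq aff_0_funpow fun_eq_iff)
  \<comment> \<open>From the fixed residue 0, each step by 1 in the argument becomes a step by
    \<open>R\<close> in the value.\<close>
  have nat: "\<beta> (idx (int n)) = idx (R * int n)" for n
  proof (induction n)
    case 0
    have "idx 0 = 1" by (simp add: idx_def)
    then show ?case using outside[of 1] by simp
  next
    case (Suc n)
    then show ?case using conj[of "idx (int n)"] by (simp add: algebra_simps)
  qed
  have "\<beta> = aff 1 0"
  proof (rule perm_eqI)
    fix i assume "i \<notin> {1..p}"
    then show "\<beta> i = aff 1 0 i" using outside[of i] by (auto simp: aff_outside)
  next
    fix t
    obtain n where "idx t = idx (int n)" "[int n = t] (mod P)"
      using that[of "nat (t mod P)"] by (simp add: idx_eq_iff)
    then show "\<beta> (idx t) = aff 1 0 (idx t)" using nat[of n] by simp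
  qed
  then show ?thesis using class_sizes_G center_G by simp
qed

end
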